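(* Let $(\theta_t,u(i,t))_{0\le t\le T,\,i\in\{0,1\}}$ be a mean field game Nash equilibrium with initial value $\overline\theta\in[0,1]$, and let $\alpha(i,t)=(u(i,t)-u(1-i,t))_+$ be the associated decentralized strategy. For each $N$ consider the $N+1$ player game with initial states such that the number $n(0)$ of players in state 0 at time 0 satisfies $n(0)/N\to\overline\theta$ as $N\to\infty$. Then there exist $\epsilon_N\ge0$ with $\epsilon_N\to0$ as $N\to\infty$ such that, for each $N$, the strategy profile in which every player uses $\alpha(i,t)$ (with $i$ the player's own current state) is an $\epsilon_N$-Nash equilibrium of the $N+1$ player game.
   Context: Fix $T>0$, $\eta\ge0$, and functions $f,\psi:\{0,1\}\times[0,1]\to\mathbb R$ that are bounded and uniformly Lipschitz continuous in the second argument. Write $a_+=\max(a,0)$. The $N+1$ player game. Each player has state in $\{0,1\}$. A state feedback (Markov) control for a player is a nonnegative function $\alpha(i,n,t)$ of the player's own state $i$, the number $n\in\{0,\dots,N\}$ of other players in state 0, and $t\in[0,T]$; a decentralized control is one not depending on $n$. A player using control $\alpha$ jumps from $i$ to $1-i$ at rate $\alpha(i,n,t)+\eta$; conditionally on the current states, players jump independently. Each player's expected cost is $E\big[\int_0^T (f(i(t),\theta_t)+\tfrac12\alpha_t^2)\,dt+\psi(i(T),\theta_T)\big]$, where here $\theta_t$ is the fraction of the other $N$ players in state 0 and $\alpha_t$ is the player's control value at time $t$. A strategy profile is an $\epsilon$-Nash equilibrium if no player can reduce their expected cost by more than $\epsilon$ by unilaterally deviating to another control. A mean field game Nash equilibrium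 with initial value $\overline\theta$ is a solution $(\theta_t,u(i,t))$ of $$\dot\theta_t=(1-\theta_t)\big((u(1,t)-u(0,t))_+ +\eta\big)-\theta_t\big((u(0,t)-u(1,t))_+ +\eta\big),$$ $$-\dot u(i,t)=f(i,\theta_t)-\eta(u(i,t)-u(1-i,t))-\tfrac12\big((u(i,t)-u(1-i,t))_+\big)^2,$$ $\theta_0=\overline\theta$, $u(i,T)=\psi(i,\theta_T)$. *)

theory Defs
  imports "HOL-Probability.Probability" "HOL-Library.Z2"
begin

text \<open>
  A player's state lives in \<^typ>\<open>bit\<close>, so \<open>1 - i\<close> is the other state.  The players of the
  \<open>N + 1\<close> player game are numbered \<open>0, \<dots>, N\<close>; a configuration assigns a state to each of them.
\<close>

definition configs :: "nat \<Rightarrow> (nat \<Rightarrow> bit) set" where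
  "configs N = ({..N} \<rightarrow>\<^sub>E UNIV)"

definition others0 :: "nat \<Rightarrow> nat \<Rightarrow> (nat \<Rightarrow> bit) \<Rightarrow> nat" where
  "others0 N k x = card {j. j \<le> N \<and> j \<noteq> k \<and> x j = 0}"

definition frac0 :: "nat \<Rightarrow> nat \<Rightarrow> (nat \<Rightarrow> bit) \<Rightarrow> real" where
  "frac0 N k x = real (others0 N k x) / real N"

definition flip :: "nat \<Rightarrow> (nat \<Rightarrow> bit) \<Rightarrow> (nat \<Rightarrow> bit)" where
  "flip k x = x(k := 1 - x k)"

text \<open>
  A Markov control \<open>a i n t\<close> takes the player's own state \<open>i\<close>, the number \<open>n\<close> of other players
  in state 0, and the time \<open>t\<close>.  A profile assigns a control to each player.
\<close>

type_synonym control = "bit \<Rightarrow> nat \<Rightarrow> real \<Rightarrow> real"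

definition is_control :: "nat \<Rightarrow> real \<Rightarrow> control \<Rightarrow> bool" where
  "is_control N T a \<longleftrightarrow>
     (\<forall>i. \<forall>n\<le>N. a i n \<in> borel_measurable (restrict_space borel {0..T}) \<and> (\<forall>t\<in>{0..T}. 0 \<le> a i n t))"

definition control_value :: "nat \<Rightarrow> (nat \<Rightarrow> control) \<Rightarrow> nat \<Rightarrow> (nat \<Rightarrow> bit) \<Rightarrow> real \<Rightarrow> real" where
  "control_value N a k x t = a k (x k) (others0 N k x) t"

definition jump_rate :: "nat \<Rightarrow> real \<Rightarrow> (nat \<Rightarrow> control) \<Rightarrow> nat \<Rightarrow> (nat \<Rightarrow> bit) \<Rightarrow> real \<Rightarrow> real" where
  "jump_rate N \<eta> a k x t = control_value N a k x t + \<eta>"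

definition history :: "'w measure \<Rightarrow> (real \<Rightarrow> 'w \<Rightarrow> nat \<Rightarrow> bit) \<Rightarrow> real \<Rightarrow> 'w set set" where
  "history M X s = sigma_sets (space M) {{\<omega> \<in> space M. X r \<omega> = y} | r y. 0 \<le> r \<and> r \<le> s}"

definition cadlag_path :: "real \<Rightarrow> (real \<Rightarrow> nat \<Rightarrow> bit) \<Rightarrow> bool" where
  "cadlag_path T p \<longleftrightarrow>
     (\<forall>t\<in>{0..<T}. \<forall>\<^sub>F r in at_right t. p r = p t) \<and>
     (\<forall>t\<in>{0<..T}. \<exists>x. \<forall>\<^sub>F r in at_left t. p r = x)"

text \<open>
  \<open>X\<close> is the time-inhomogeneous Markov jump process on configurations, started at \<open>x0\<close>, in which
  each player \<open>k\<close> independently flips its state at rate \<open>jump_rate N \<eta> a k x t\<close>.  Since the rates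
  are only measurable in time, this is expressed in integrated form: conditionally on any event \<open>A\<close>
  of the past up to time \<open>s\<close>, the distribution of the configuration obeys the Kolmogorov forward
  equation from time \<open>s\<close> on.  Only single flips have positive rate, so no two players jump
  simultaneously.  The integrability clause says that the expected number of jumps is finite; it
  excludes only processes of infinite quadratic control cost.
\<close>

definition game_process ::
  "nat \<Rightarrow> real \<Rightarrow> real \<Rightarrow> (nat \<Rightarrow> control) \<Rightarrow> (nat \<Rightarrow> bit) \<Rightarrow>
   'w measure \<Rightarrow> (real \<Rightarrow> 'w \<Rightarrow> nat \<Rightarrow> bit) \<Rightarrow> bool" where
  "game_process N T \<eta> a x0 M X \<longleftrightarrow>
     prob_space M \<and>
     (\<forall>t\<in>{0..T}. X t \<in> measurable M (count_space (configs N))) \<and>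
     (\<forall>\<omega>\<in>space M. cadlag_path T (\<lambda>t. X t \<omega>) \<and> X 0 \<omega> = x0) \<and>
     (\<forall>k\<le>N. \<forall>y\<in>configs N.
        set_integrable lborel {0..T}
          (\<lambda>r. measure M {\<omega> \<in> space M. X r \<omega> = y} * jump_rate N \<eta> a k y r)) \<and>
     (\<forall>s t. 0 \<le> s \<longrightarrow> s \<le> t \<longrightarrow> t \<le> T \<longrightarrow>
        (\<forall>A\<in>history M X s. \<forall>y\<in>configs N.
           measure M {\<omega> \<in> A. X t \<omega> = y} =
             measure M {\<omega> \<in> A. X s \<omega> = y} +
             (\<Sum>k\<le>N. LINT r:{s..t}|lborel.
                measure M {\<omega> \<in> A. X r \<omega> = flip k y} * jump_rate N \<eta> a k (flip k y) r
                - measure M {\<omega> \<in> A. X r \<omega> = y} * jump_rate N \<eta> a k y r)))"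

text \<open>
  The expected cost of player \<open>k\<close>.  The quadratic control cost may be infinite, hence the extended
  real value; the contributions of \<open>f\<close> and \<open>\<psi>\<close> are bounded.
\<close>

definition expected_cost ::
  "nat \<Rightarrow> real \<Rightarrow> (bit \<Rightarrow> real \<Rightarrow> real) \<Rightarrow> (bit \<Rightarrow> real \<Rightarrow> real) \<Rightarrow> (nat \<Rightarrow> control) \<Rightarrow> nat \<Rightarrow>
   'w measure \<Rightarrow> (real \<Rightarrow> 'w \<Rightarrow> nat \<Rightarrow> bit) \<Rightarrow> ereal" where
  "expected_cost N T f \<psi> a k M X =
     ereal (\<integral>\<omega>. (LINT t:{0..T}|lborel. f (X t \<omega> k) (frac0 N k (X t \<omega>)))
                + \<psi> (X T \<omega> k) (frac0 N k (X T \<omega>)) \<partial>M)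
     + enn2ereal (\<integral>\<^sup>+\<omega>. (\<integral>\<^sup>+t\<in>{0..T}. ennreal (1/2 * (control_value N a k (X t \<omega>) t)\<^sup>2) \<partial>lborel) \<partial>M)"

text \<open>
  Processes are weak solutions, unique in law, so the costs are compared for arbitrary realizations
  of the game.  Any cadlag process can be realized through its law on the path space used here.
\<close>

type_synonym path = "real \<Rightarrow> nat \<Rightarrow> bit"

definition eps_nash ::
  "nat \<Rightarrow> real \<Rightarrow> real \<Rightarrow> (bit \<Rightarrow> real \<Rightarrow> real) \<Rightarrow> (bit \<Rightarrow> real \<Rightarrow> real) \<Rightarrow> (nat \<Rightarrow> bit) \<Rightarrow>
   (nat \<Rightarrow> control) \<Rightarrow> real \<Rightarrow> bool" where
  "eps_nash N T \<eta> f \<psi> x0 a \<epsilon> \<longleftrightarrow>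
     (\<forall>k\<le>N. is_control N T (a k)) \<and>
     (\<forall>k\<le>N. \<forall>b. is_control N T b \<longrightarrow>
        (\<forall>(M :: path measure) X (M' :: path measure) X'.
           game_process N T \<eta> a x0 M X \<longrightarrow>
           game_process N T \<eta> (a(k := b)) x0 M' X' \<longrightarrow>
           expected_cost N T f \<psi> a k M X \<le> expected_cost N T f \<psi> (a(k := b)) k M' X' + ereal \<epsilon>))"

abbreviation pos :: "real \<Rightarrow> real" where
  "pos a \<equiv> max a 0"

text \<open>
  \<open>f\<close> and \<open>\<psi>\<close> are given on \<open>[0,1]\<close> only, so a solution takes values \<open>\<theta> t \<in> [0,1]\<close>.
  Derivatives at the end points of \<open>[0,T]\<close> are one-sided.
\<close>

definition mfg_equilibrium ::
  "real \<Rightarrow> real \<Rightarrow> (bit \<Rightarrow> real \<Rightarrow> real) \<Rightarrow> (bit \<Rightarrow> real \<Rightarrow> real) \<Rightarrow> real \<Rightarrow>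
   (real \<Rightarrow> real) \<Rightarrow> (bit \<Rightarrow> real \<Rightarrow> real) \<Rightarrow> bool" where
  "mfg_equilibrium T \<eta> f \<psi> \<theta>0 \<theta> u \<longleftrightarrow>
     (\<forall>t\<in>{0..T}. \<theta> t \<in> {0..1}) \<and>
     (\<forall>t\<in>{0..T}.
        (\<theta> has_real_derivative
           (1 - \<theta> t) * (pos (u 1 t - u 0 t) + \<eta>) - \<theta> t * (pos (u 0 t - u 1 t) + \<eta>))
          (at t within {0..T})) \<and>
     (\<forall>i. \<forall>t\<in>{0..T}.
        (u i has_real_derivative
           - (f i (\<theta> t) - \<eta> * (u i t - u (1 - i) t) - 1/2 * (pos (u i t - u (1 - i) t))\<^sup>2))
          (at t within {0..T})) \<and>
     \<theta> 0 = \<theta>0 \<and> (\<forall>i. u i T = \<psi> i (\<theta> T))"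

definition admissible_cost :: "(bit \<Rightarrow> real \<Rightarrow> real) \<Rightarrow> bool" where
  "admissible_cost g \<longleftrightarrow>
     (\<exists>C. \<forall>i. \<forall>x\<in>{0..1}. \<bar>g i x\<bar> \<le> C) \<and> (\<exists>L. \<forall>i. L-lipschitz_on {0..1} (g i))"

end

theory Submission
  imports Defs
begin

text \<open>
  Only the one-time marginals of the game matter: they determine the expected cost, and by the
  forward equation they satisfy Dynkin's formula.  When all players but \<open>k\<close> use the equilibrium
  strategy, the number of others in state 0 does not depend on what player \<open>k\<close> does, and Dynkin's
  formula for \<open>(m - \<theta>)\<^sup>2\<close>, where \<open>m\<close> is the fraction of others in state 0, shows that
  \<open>E (m\<^sub>t - \<theta>\<^sub>t)\<^sup>2\<close> is at most \<open>D = (m\<^sub>0 - \<theta>\<^sub>0)\<^sup>2 + K T / N\<close>, whatever control player \<open>k\<close> uses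
  (\<open>K\<close> bounds the equilibrium jump rates).  Replacing \<open>m\<close> by \<open>\<theta>\<close> in the costs, with Lipschitz
  constant \<open>L\<close>, therefore changes them by at most \<open>L (T + 1) \<surd>D\<close>.  After this
  replacement, Dynkin's formula for \<open>u\<close> (the verification argument, i.e. completing the square in
  the Hamilton-Jacobi-Bellman equation) shows that the cost is at least \<open>u (x\<^sub>0 k) 0\<close>, with equality
  for the equilibrium strategy.
\<close>

section \<open>Lebesgue integration on intervals\<close>

text \<open>Tonelli: the iterated integral of the norm factors into the two L1 norms. This supplies
  the integrable kernel for the Fubini argument that follows.\<close>

lemma integrable_times_pair_lborel:
  fixes f g :: "real \<Rightarrow> real"
  assumes f: "integrable lborel f" and g: "integrable lborel g"
  shows "integrable (lborel \<Otimes>\<^sub>M lborel) (\<lambda>(s, r). f s * g r)"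
proof -
  have [measurable]: "f \<in> borel_measurable lborel" "g \<in> borel_measurable lborel"
    using f g by auto
  have "(\<lambda>(s, r). f s * g r) \<in> borel_measurable (lborel \<Otimes>\<^sub>M lborel)"
    by measurable
  moreover have "integrable lborel (\<lambda>s. \<integral>r. norm (f s * g r) \<partial>lborel)"
    using f by (simp add: abs_mult)
  ultimately show ?thesis
    using g by (intro lborel_pair.Fubini_integrable) auto
qed

text \<open>The jump rates are only measurable in time, so \<open>P\<close> is merely an indefinite
  integral and the product rule is obtained in integrated form. Both \<open>g t - g s\<close> and
  \<open>P r - P 0\<close> are integrals, of \<open>g'\<close> over \<open>r \<ge> s\<close> and of
  \<open>q\<close> over \<open>s \<le> r\<close>, so the two remainder terms are one double integral
  over a triangle, evaluated in two orders.\<close>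

lemma indefinite_integral_by_parts:
  fixes q g g' P :: "real \<Rightarrow> real"
  assumes t: "0 \<le> t"
    and q: "set_integrable lborel {0..t} q"
    and P: "\<And>s. s \<in> {0..t} \<Longrightarrow> P s = P 0 + (LINT r:{0..s}|lborel. q r)"
    and g: "\<And>s. s \<in> {0..t} \<Longrightarrow> (g has_real_derivative g' s) (at s within {0..t})"
    and g': "continuous_on {0..t} g'"
  shows "set_integrable lborel {0..t} (\<lambda>s. q s * g s + P s * g' s)"
    and "P t * g t - P 0 * g 0 = (LINT s:{0..t}|lborel. q s * g s + P s * g' s)"
proof -
  define Q where "Q s = indicator {0..t} s * q s" for s
  define G where "G s = indicator {0..t} s * g' s" for s
  define K where "K s r = indicator {s..} r * (Q s * G r)" for s r
  have Q: "integrable lborel Q"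
    using q unfolding set_integrable_def Q_def by simp
  have G: "integrable lborel G"
    using borel_integrable_compact[OF compact_Icc g'] unfolding G_def by (simp add: set_integrable_def)
  have K: "integrable (lborel \<Otimes>\<^sub>M lborel) (\<lambda>(s, r). K s r)"
  proof -
    have "{x \<in> space (lborel \<Otimes>\<^sub>M lborel). fst x \<le> snd x} \<in> sets (lborel \<Otimes>\<^sub>M (lborel :: real measure))"
      by measurable
    from integrable_mult_indicator[OF this integrable_times_pair_lborel[OF Q G]]
    show ?thesis
      by (rule back_subst[of "integrable _"])
        (auto simp: K_def fun_eq_iff indicator_def space_pair_measure)
  qed
  have FTC: "(LINT r:{a..b}|lborel. g' r) = g b - g a" if "0 \<le> a" "a \<le> b" "b \<le> t" for a b
  proof -
    have "(\<integral>x. indicator {a .. b} x *\<^sub>R g' x \<partial>lborel) = g b - g a"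
    proof (rule integral_FTC_Icc[OF \<open>a \<le> b\<close>])
      fix x assume "a \<le> x" "x \<le> b"
      then have "(g has_real_derivative g' x) (at x within {a..b})"
        using that g[of x] by (auto intro: DERIV_subset)
      then show "(g has_vector_derivative g' x) (at x within {a..b})"
        by (simp add: has_real_derivative_iff_has_vector_derivative)
    next
      show "continuous_on {a..b} g'"
        using that by (intro continuous_on_subset[OF g']) auto
    qed
    then show ?thesis by (simp add: set_lebesgue_integral_def)
  qed
  have inner_r: "(\<integral>r. K s r \<partial>lborel) = Q s * (g t - g s)" for s
  proof (cases "s \<in> {0..t}")
    case True
    have "(\<integral>r. K s r \<partial>lborel) = (\<integral>r. Q s * (indicator {s..t} r * g' r) \<partial>lborel)"
      using True by (intro Bochner_Integration.integral_cong) (auto simp: K_def G_def indicator_def)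
    also have "\<dots> = Q s * (LINT r:{s..t}|lborel. g' r)"
      by (simp add: set_lebesgue_integral_def)
    finally show ?thesis using FTC[of s t] True by simp
  qed (simp add: K_def Q_def)
  have inner_s: "(\<integral>s. K s r \<partial>lborel) = G r * (P r - P 0)" for r
  proof (cases "r \<in> {0..t}")
    case True
    have "(\<integral>s. K s r \<partial>lborel) = (\<integral>s. G r * (indicator {0..r} s * q s) \<partial>lborel)"
      using True by (intro Bochner_Integration.integral_cong) (auto simp: K_def Q_def indicator_def)
    also have "\<dots> = G r * (LINT s:{0..r}|lborel. q s)"
      by (simp add: set_lebesgue_integral_def)
    finally show ?thesis using P[OF True] by simp
  qed (simp add: K_def G_def)
  have 1: "integrable lborel (\<lambda>s. Q s * (g t - g s))"
    using lborel_pair.integrable_fst[OF K] by (simp add: inner_r)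
  have 2: "integrable lborel (\<lambda>r. G r * (P r - P 0))"
    using lborel_pair.integrable_snd[OF K] by (simp add: inner_s)
  have swap: "(\<integral>s. Q s * (g t - g s) \<partial>lborel) = (\<integral>r. G r * (P r - P 0) \<partial>lborel)"
    using lborel_pair.Fubini_integral[OF K] by (simp add: inner_r inner_s)
  \<comment> \<open>The second and third summands have equal integrals by \<open>swap\<close> and
    cancel; only boundary terms remain.\<close>
  have split: "indicator {0..t} s *\<^sub>R (q s * g s + P s * g' s) =
      Q s * g t - Q s * (g t - g s) + (G s * (P s - P 0) + G s * P 0)" for s
    by (simp add: Q_def G_def algebra_simps)
  have "integrable lborel (\<lambda>s. Q s * g t)" "integrable lborel (\<lambda>s. G s * P 0)"
    using Q G by auto
  note I = 1 2 this
  show "set_integrable lborel {0..t} (\<lambda>s. q s * g s + P s * g' s)"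
    unfolding set_integrable_def split using I
    by (intro Bochner_Integration.integrable_add Bochner_Integration.integrable_diff) simp_all
  have "(LINT s:{0..t}|lborel. q s * g s + P s * g' s) =
     (\<integral>s. Q s * g t \<partial>lborel) - (\<integral>s. Q s * (g t - g s) \<partial>lborel)
     + ((\<integral>r. G r * (P r - P 0) \<partial>lborel) + (\<integral>s. G s * P 0 \<partial>lborel))"
    unfolding set_lebesgue_integral_def split using I by simp
  also have "\<dots> = g t * (\<integral>s. Q s \<partial>lborel) + P 0 * (\<integral>s. G s \<partial>lborel)"
    unfolding swap by simp
  also have "(\<integral>s. Q s \<partial>lborel) = P t - P 0"
    using P[of t] t by (simp add: Q_def set_lebesgue_integral_def)
  also have "(\<integral>s. G s \<partial>lborel) = g t - g 0"
    using FTC[of 0 t] t by (simp add: G_def set_lebesgue_integral_def)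
  finally show "P t * g t - P 0 * g 0 = (LINT s:{0..t}|lborel. q s * g s + P s * g' s)"
    by (simp add: algebra_simps)
qed

lemma set_integrable_sum:
  fixes f :: "'i \<Rightarrow> 'a \<Rightarrow> real"
  assumes "\<And>i. i \<in> I \<Longrightarrow> set_integrable M A (f i)"
  shows "set_integrable M A (\<lambda>x. \<Sum>i\<in>I. f i x)"
  using assms unfolding set_integrable_def real_scaleR_def sum_distrib_left
  by (rule Bochner_Integration.integrable_sum)

lemma set_integral_sum:
  fixes f :: "'i \<Rightarrow> 'a \<Rightarrow> real"
  assumes "\<And>i. i \<in> I \<Longrightarrow> set_integrable M A (f i)"
  shows "(LINT x:A|M. \<Sum>i\<in>I. f i x) = (\<Sum>i\<in>I. LINT x:A|M. f i x)"
  using assms unfolding set_integrable_def set_lebesgue_integral_def real_scaleR_def sum_distrib_left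
  by (rule Bochner_Integration.integral_sum)

lemma set_integral_const_Icc:
  fixes c :: real
  assumes "0 \<le> t"
  shows "set_integrable lborel {0..t} (\<lambda>s. c)" and "(LINT s:{0..t}|lborel. c) = c * t"
  using assms by (auto simp: set_lebesgue_integral_def intro!: borel_integrable_atLeastAtMost')

section \<open>Configurations\<close>

lemma flip_flip [simp]: "flip k (flip k x) = x"
  by (cases "x k") (simp_all add: flip_def fun_eq_iff)

lemma flip_apply: "flip k x j = (if j = k then 1 - x k else x j)"
  by (simp add: flip_def)

lemma flip_in_configs_iff [simp]: "k \<le> N \<Longrightarrow> flip k x \<in> configs N \<longleftrightarrow> x \<in> configs N"
  by (auto simp: configs_def PiE_iff extensional_def flip_def)

lemma finite_UNIV_bit: "finite (UNIV :: bit set)"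
proof -
  have "(UNIV :: bit set) = {0, 1}" by (auto intro: bit.exhaust)
  then show ?thesis by (metis finite.emptyI finite.insertI)
qed

lemma finite_configs [simp]: "finite (configs N)"
  unfolding configs_def by (intro finite_PiE finite_UNIV_bit) auto

lemma sum_flip_configs:
  assumes "k \<le> N"
  shows "(\<Sum>y\<in>configs N. h (flip k y)) = (\<Sum>y\<in>configs N. h y)"
  by (rule sum.reindex_bij_witness[of _ "flip k" "flip k"]) (use assms in auto)

text \<open>Player \<open>k\<close> is excluded from the count. Hence the control of
  \<open>k\<close> drops out of the drift of any function of \<open>frac0 N k\<close>.\<close>

lemma others0_flip_self [simp]: "others0 N k (flip k y) = others0 N k y"
  unfolding others0_def by (rule arg_cong[where f = card]) (auto simp: flip_def)

lemma frac0_flip_self [simp]: "frac0 N k (flip k y) = frac0 N k y"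
  by (simp add: frac0_def)

lemma others0_flip_from_0:
  assumes "j \<le> N" "j \<noteq> k" "y j = 0"
  shows "others0 N k y = Suc (others0 N k (flip j y))"
proof -
  have "{i. i \<le> N \<and> i \<noteq> k \<and> y i = 0} = insert j {i. i \<le> N \<and> i \<noteq> k \<and> flip j y i = 0}"
    using assms by (auto simp: flip_def)
  moreover have "j \<notin> {i. i \<le> N \<and> i \<noteq> k \<and> flip j y i = 0}"
    using assms by (auto simp: flip_def)
  ultimately show ?thesis unfolding others0_def by simp
qed

lemma others0_flip_from_1:
  assumes "j \<le> N" "j \<noteq> k" "y j = 1"
  shows "others0 N k (flip j y) = Suc (others0 N k y)"
  using others0_flip_from_0[of j N k "flip j y"] assms by (simp add: flip_def fun_upd_idem)

lemma others0_le: "k \<le> N \<Longrightarrow> others0 N k y \<le> N"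
proof -
  assume "k \<le> N"
  have "others0 N k y \<le> card ({..N} - {k})"
    unfolding others0_def by (rule card_mono) auto
  then show ?thesis using \<open>k \<le> N\<close> by simp
qed

text \<open>Of the \<open>N + 1\<close> players the one not counted is \<open>k\<close>, so at most
  \<open>N\<close> remain. For \<open>N = 0\<close> the quotient is 0 by convention.\<close>

lemma frac0_unit_interval: "k \<le> N \<Longrightarrow> frac0 N k y \<in> {0..1}"
  using others0_le[of k N y] by (auto simp: frac0_def divide_le_eq_1)

section \<open>Realizations of the game\<close>

locale game_realization =
  fixes N :: nat and T \<eta> :: real and a :: "nat \<Rightarrow> control" and x0 :: "nat \<Rightarrow> bit"
    and M :: "'w measure" and X :: "real \<Rightarrow> 'w \<Rightarrow> nat \<Rightarrow> bit"
  assumes T_pos: "0 < T" and process: "game_process N T \<eta> a x0 M X"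
begin

sublocale prob_space M
  using process by (simp add: game_process_def)

lemma X_measurable: "t \<in> {0..T} \<Longrightarrow> X t \<in> measurable M (count_space (configs N))"
  using process by (simp add: game_process_def)

lemma X_in_configs: "t \<in> {0..T} \<Longrightarrow> \<omega> \<in> space M \<Longrightarrow> X t \<omega> \<in> configs N"
  using measurable_space[OF X_measurable] by fastforce

lemma X_event [measurable]:
  assumes "t \<in> {0..T}" shows "{\<omega> \<in> space M. X t \<omega> = y} \<in> sets M"
proof (cases "y \<in> configs N")
  case True
  have "X t -` {y} \<inter> space M \<in> sets M"
    using True by (intro measurable_sets[OF X_measurable[OF assms]]) auto
  moreover have "X t -` {y} \<inter> space M = {\<omega> \<in> space M. X t \<omega> = y}" by auto
  ultimately show ?thesis by simp
next
  case False
  then have "{\<omega> \<in> space M. X t \<omega> = y} = {}" using X_in_configs[OF assms] by auto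
  then show ?thesis by (metis sets.empty_sets)
qed

section \<open>One-time marginals of the configuration process\<close>

definition marginal :: "real \<Rightarrow> (nat \<Rightarrow> bit) \<Rightarrow> real" where
  "marginal t y = prob {\<omega> \<in> space M. X t \<omega> = y}"

lemma marginal_nonneg [simp]: "0 \<le> marginal t y"
  by (simp add: marginal_def)

lemma X_0: "\<omega> \<in> space M \<Longrightarrow> X 0 \<omega> = x0"
  using process by (simp add: game_process_def)

lemma x0_in_configs: "x0 \<in> configs N"
  using not_empty X_in_configs[of 0] X_0 T_pos by fastforce

lemma marginal_0: "marginal 0 y = (if y = x0 then 1 else 0)"
proof -
  have "{\<omega> \<in> space M. X 0 \<omega> = y} = (if y = x0 then space M else {})"
    using X_0 by auto
  then show ?thesis by (auto simp: marginal_def prob_space)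
qed

text \<open>There are finitely many configurations, so \<open>h (X t)\<close> is a finite
  combination of indicators of events, whatever \<open>h\<close> is.\<close>

lemma expectation_eq_sum_marginal:
  fixes h :: "(nat \<Rightarrow> bit) \<Rightarrow> real"
  assumes t: "t \<in> {0..T}"
  shows "integrable M (\<lambda>\<omega>. h (X t \<omega>))"
    and "(\<integral>\<omega>. h (X t \<omega>) \<partial>M) = (\<Sum>y\<in>configs N. marginal t y * h y)"
proof -
  let ?E = "\<lambda>y. {\<omega> \<in> space M. X t \<omega> = y}"
  have eq: "h (X t \<omega>) = (\<Sum>y\<in>configs N. indicator (?E y) \<omega> * h y)" if "\<omega> \<in> space M" for \<omega>
  proof -
    have "(\<Sum>y\<in>configs N. indicator (?E y) \<omega> * h y) = (\<Sum>y\<in>configs N. if y = X t \<omega> then h y else 0)"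
      using that by (intro sum.cong) (auto simp: indicator_def)
    also have "\<dots> = h (X t \<omega>)" using X_in_configs[OF t that] by simp
    finally show ?thesis by simp
  qed
  have i: "integrable M (\<lambda>\<omega>. indicator (?E y) \<omega> * h y)" for y
    using X_event[OF t] by (intro integrable_mult_left integrable_real_indicator) (auto simp: emeasure_eq_measure)
  show "integrable M (\<lambda>\<omega>. h (X t \<omega>))"
    by (subst Bochner_Integration.integrable_cong[OF refl eq])
      (auto simp del: sum_indicator_mult intro!: Bochner_Integration.integrable_sum i)
  have "(\<integral>\<omega>. h (X t \<omega>) \<partial>M) = (\<integral>\<omega>. (\<Sum>y\<in>configs N. indicator (?E y) \<omega> * h y) \<partial>M)"
    by (rule Bochner_Integration.integral_cong[OF refl eq])
  also have "\<dots> = (\<Sum>y\<in>configs N. marginal t y * h y)"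
  proof (subst Bochner_Integration.integral_sum[OF i], intro sum.cong refl)
    fix y
    have "?E y \<inter> space M = ?E y" by auto
    then show "(\<integral>\<omega>. indicator (?E y) \<omega> * h y \<partial>M) = marginal t y * h y"
      by (simp add: marginal_def)
  qed
  finally show "(\<integral>\<omega>. h (X t \<omega>) \<partial>M) = (\<Sum>y\<in>configs N. marginal t y * h y)" .
qed

lemma sum_marginal: "t \<in> {0..T} \<Longrightarrow> (\<Sum>y\<in>configs N. marginal t y) = 1"
  using expectation_eq_sum_marginal(2)[of t "\<lambda>_. 1"] by (simp add: prob_space)

section \<open>Forward equation and Dynkin's formula\<close>

lemma rate_integrable:
  assumes "k \<le> N" "y \<in> configs N" "0 \<le> t" "t \<le> T"
  shows "set_integrable lborel {0..t} (\<lambda>r. marginal r y * jump_rate N \<eta> a k y r)"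
proof -
  have "set_integrable lborel {0..T} (\<lambda>r. marginal r y * jump_rate N \<eta> a k y r)"
    using process assms by (simp add: game_process_def marginal_def)
  then show ?thesis by (rule set_integrable_subset) (use assms in auto)
qed

text \<open>The right-hand side of the master equation at \<open>y\<close>: as \<open>flip k\<close>
  is an involution, a jump of player \<open>k\<close> leads into \<open>y\<close> exactly from
  \<open>flip k y\<close>.\<close>

definition net_inflow :: "(nat \<Rightarrow> bit) \<Rightarrow> real \<Rightarrow> real" where
  "net_inflow y r = (\<Sum>k\<le>N. marginal r (flip k y) * jump_rate N \<eta> a k (flip k y) r
                         - marginal r y * jump_rate N \<eta> a k y r)"

lemma net_inflow_integrable:
  assumes "y \<in> configs N" "0 \<le> t" "t \<le> T"
  shows "set_integrable lborel {0..t} (net_inflow y)"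
  unfolding net_inflow_def using assms
  by (intro set_integrable_sum set_integral_diff rate_integrable) auto

text \<open>The conditional forward equation for the event \<open>space M\<close> at time 0, which
  lies in every history.\<close>

lemma forward_equation:
  assumes y: "y \<in> configs N" and t: "0 \<le> t" "t \<le> T"
  shows "marginal t y = marginal 0 y + (LINT r:{0..t}|lborel. net_inflow y r)"
proof -
  have "space M \<in> history M X 0"
    unfolding history_def by (rule sigma_sets_top)
  then have "marginal t y = marginal 0 y +
      (\<Sum>k\<le>N. LINT r:{0..t}|lborel. marginal r (flip k y) * jump_rate N \<eta> a k (flip k y) r
                - marginal r y * jump_rate N \<eta> a k y r)"
    using process assms by (simp add: game_process_def marginal_def)
  also have "(\<Sum>k\<le>N. LINT r:{0..t}|lborel. marginal r (flip k y) * jump_rate N \<eta> a k (flip k y) r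
                - marginal r y * jump_rate N \<eta> a k y r) = (LINT r:{0..t}|lborel. net_inflow y r)"
    unfolding net_inflow_def using assms
    by (subst set_integral_sum) (auto intro!: set_integral_diff rate_integrable)
  finally show ?thesis .
qed

definition generator :: "((nat \<Rightarrow> bit) \<Rightarrow> real) \<Rightarrow> (nat \<Rightarrow> bit) \<Rightarrow> real \<Rightarrow> real" where
  "generator h y s = (\<Sum>k\<le>N. jump_rate N \<eta> a k y s * (h (flip k y) - h y))"

text \<open>The forward operator is the adjoint of the generator: reindexing each inflow term by
  \<open>flip k\<close> moves the jump from the marginal onto \<open>h\<close>.\<close>

lemma sum_net_inflow:
  "(\<Sum>y\<in>configs N. net_inflow y s * h y) = (\<Sum>y\<in>configs N. marginal s y * generator h y s)"
proof -
  let ?w = "\<lambda>k y. marginal s y * jump_rate N \<eta> a k y s"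
  have "(\<Sum>y\<in>configs N. net_inflow y s * h y) =
      (\<Sum>k\<le>N. (\<Sum>y\<in>configs N. ?w k (flip k y) * h y) - (\<Sum>y\<in>configs N. ?w k y * h y))"
    unfolding net_inflow_def sum_distrib_right
    by (subst sum.swap) (simp add: left_diff_distrib sum_subtractf)
  also have "\<dots> = (\<Sum>k\<le>N. (\<Sum>y\<in>configs N. ?w k y * h (flip k y)) - (\<Sum>y\<in>configs N. ?w k y * h y))"
  proof (rule sum.cong[OF refl])
    fix k assume "k \<in> {..N}"
    then show "(\<Sum>y\<in>configs N. ?w k (flip k y) * h y) - (\<Sum>y\<in>configs N. ?w k y * h y) =
        (\<Sum>y\<in>configs N. ?w k y * h (flip k y)) - (\<Sum>y\<in>configs N. ?w k y * h y)"
      using sum_flip_configs[of k N "\<lambda>y. ?w k y * h (flip k y)"] by simp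
  qed
  also have "\<dots> = (\<Sum>y\<in>configs N. marginal s y * generator h y s)"
    unfolding generator_def sum_distrib_left
    by (subst sum.swap) (simp add: sum_subtractf algebra_simps)
  finally show ?thesis .
qed

text \<open>For each of the finitely many configurations, integrate by parts the product of the
  marginal with \<open>H y\<close>. After summation over \<open>y\<close>, the duality
  \<open>sum_net_inflow\<close> turns the flow terms into the generator of \<open>H\<close>. The
  argument uses marginals only.\<close>

lemma Dynkin_formula:
  fixes H H' :: "(nat \<Rightarrow> bit) \<Rightarrow> real \<Rightarrow> real"
  assumes t: "0 \<le> t" "t \<le> T"
    and H: "\<And>y s. y \<in> configs N \<Longrightarrow> s \<in> {0..T} \<Longrightarrow> (H y has_real_derivative H' y s) (at s within {0..T})"
    and H': "\<And>y. y \<in> configs N \<Longrightarrow> continuous_on {0..T} (H' y)"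
  shows "set_integrable lborel {0..t}
           (\<lambda>s. \<Sum>y\<in>configs N. marginal s y * (H' y s + generator (\<lambda>z. H z s) y s))"
    and "(\<Sum>y\<in>configs N. marginal t y * H y t) = H x0 0 +
           (LINT s:{0..t}|lborel. \<Sum>y\<in>configs N. marginal s y * (H' y s + generator (\<lambda>z. H z s) y s))"
proof -
  let ?F = "\<lambda>y s. net_inflow y s * H y s + marginal s y * H' y s"
  have parts: "set_integrable lborel {0..t} (?F y)"
      "marginal t y * H y t - marginal 0 y * H y 0 = (LINT s:{0..t}|lborel. ?F y s)"
    if y: "y \<in> configs N" for y
  proof -
    have d: "(H y has_real_derivative H' y s) (at s within {0..t})" if "s \<in> {0..t}" for s
      using that t by (intro DERIV_subset[OF H[OF y]]) auto
    have c: "continuous_on {0..t} (H' y)"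
      using t by (intro continuous_on_subset[OF H'[OF y]]) auto
    have P: "marginal s y = marginal 0 y + (LINT r:{0..s}|lborel. net_inflow y r)"
      if "s \<in> {0..t}" for s
      using that t by (intro forward_equation y) auto
    show "set_integrable lborel {0..t} (?F y)"
      "marginal t y * H y t - marginal 0 y * H y 0 = (LINT s:{0..t}|lborel. ?F y s)"
      using indefinite_integral_by_parts[OF t(1) net_inflow_integrable[OF y t],
          of "\<lambda>s. marginal s y", OF P d c] by auto
  qed
  have eq: "(\<Sum>y\<in>configs N. ?F y s) = (\<Sum>y\<in>configs N. marginal s y * (H' y s + generator (\<lambda>z. H z s) y s))" for s
    using sum_net_inflow[of s "\<lambda>z. H z s"] by (simp add: sum.distrib algebra_simps)
  show "set_integrable lborel {0..t}
           (\<lambda>s. \<Sum>y\<in>configs N. marginal s y * (H' y s + generator (\<lambda>z. H z s) y s))"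
    unfolding eq[symmetric] using parts by (intro set_integrable_sum) auto
  have "(\<Sum>y\<in>configs N. marginal t y * H y t) - (\<Sum>y\<in>configs N. marginal 0 y * H y 0) =
      (LINT s:{0..t}|lborel. \<Sum>y\<in>configs N. ?F y s)"
    using parts by (subst set_integral_sum) (auto simp flip: sum_subtractf)
  moreover have "(\<Sum>y\<in>configs N. marginal 0 y * H y 0) = (\<Sum>y\<in>configs N. if y = x0 then H y 0 else 0)"
    by (intro sum.cong) (auto simp: marginal_0)
  moreover have "\<dots> = H x0 0"
    using x0_in_configs by simp
  ultimately show "(\<Sum>y\<in>configs N. marginal t y * H y t) = H x0 0 +
           (LINT s:{0..t}|lborel. \<Sum>y\<in>configs N. marginal s y * (H' y s + generator (\<lambda>z. H z s) y s))"
    unfolding eq by simp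
qed

section \<open>Joint measurability in time and chance, and the expected cost in terms of
  marginals\<close>

definition occupation :: "(nat \<Rightarrow> bit) \<Rightarrow> (real \<times> 'w) set" where
  "occupation y = {p \<in> {0..T} \<times> space M. X (fst p) (snd p) = y}"

text \<open>Joint measurability: by right continuity, \<open>X t \<omega>\<close> is the eventual value of \<open>X\<close> at the
  grid points immediately after \<open>t\<close>.\<close>

lemma occupation_measurable [measurable]: "occupation y \<in> sets (lborel \<Otimes>\<^sub>M M)"
proof -
  \<comment> \<open>With \<open>z\<close> the floor of \<open>(n + 1) * t\<close>, the
    \<open>+ 1\<close> selects a grid point strictly after \<open>t\<close> at distance at most
    \<open>1 / (n + 1)\<close>. Clipping keeps it in \<open>[0,T]\<close>, where \<open>X\<close> is
    known to be measurable.\<close>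
  define \<tau> where "\<tau> n z = max 0 (min T ((of_int z + 1) / real (Suc n)))" for n and z :: int
  have \<tau>: "\<tau> n z \<in> {0..T}" for n z using T_pos by (auto simp: \<tau>_def)
  have eventual: "\<forall>\<^sub>F n in sequentially. X (\<tau> n \<lfloor>real (Suc n) * t\<rfloor>) \<omega> = X t \<omega>"
    if t: "t \<in> {0..T}" and \<omega>: "\<omega> \<in> space M" for t \<omega>
  proof (cases "t = T")
    \<comment> \<open>There is nothing to the right of \<open>T\<close>; there clipping makes the
      grid point equal to \<open>T\<close> itself.\<close>
    case True
    have "\<tau> n \<lfloor>real (Suc n) * t\<rfloor> = t" for n
    proof -
      have "real (Suc n) * t \<le> of_int \<lfloor>real (Suc n) * t\<rfloor> + 1"
        by linarith
      then have "t \<le> (of_int \<lfloor>real (Suc n) * t\<rfloor> + 1) / real (Suc n)"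
        by (simp add: field_simps)
      then show ?thesis using True t by (simp add: \<tau>_def)
    qed
    then show ?thesis by simp
  next
    case False
    then have "t < T" using t by simp
    define \<sigma> where "\<sigma> n = \<tau> n \<lfloor>real (Suc n) * t\<rfloor>" for n
    have gt: "t < \<sigma> n" for n
    proof -
      have "real (Suc n) * t < of_int \<lfloor>real (Suc n) * t\<rfloor> + 1"
        by linarith
      then have "t < (of_int \<lfloor>real (Suc n) * t\<rfloor> + 1) / real (Suc n)"
        by (simp add: field_simps)
      then show ?thesis using \<open>t < T\<close> by (simp add: \<sigma>_def \<tau>_def)
    qed
    have le: "\<sigma> n \<le> t + 1 / real (Suc n)" for n
    proof -
      have "of_int \<lfloor>real (Suc n) * t\<rfloor> \<le> real (Suc n) * t"
        by linarith
      then have "of_int \<lfloor>real (Suc n) * t\<rfloor> / real (Suc n) \<le> t"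
        by (simp add: divide_le_eq mult.commute)
      then have "(of_int \<lfloor>real (Suc n) * t\<rfloor> + 1) / real (Suc n) \<le> t + 1 / real (Suc n)"
        by (simp add: add_divide_distrib)
      then show ?thesis using t by (simp add: \<sigma>_def \<tau>_def max_def min_def)
    qed
    have "\<sigma> \<longlonglongrightarrow> t"
    proof (rule tendsto_sandwich[where f = "\<lambda>_. t"])
      show "(\<lambda>n. t + 1 / real (Suc n)) \<longlonglongrightarrow> t"
        using tendsto_add[OF tendsto_const LIMSEQ_Suc[OF lim_1_over_n], of t] by simp
    qed (use gt[THEN less_imp_le] le in \<open>auto intro!: always_eventually\<close>)
    then have "filterlim \<sigma> (at_right t) sequentially"
      using gt by (intro tendsto_imp_filterlim_at_right) auto
    moreover have "\<forall>\<^sub>F r in at_right t. X r \<omega> = X t \<omega>"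
      using process t \<omega> \<open>t < T\<close> by (simp add: game_process_def cadlag_path_def)
    ultimately have "\<forall>\<^sub>F n in sequentially. X (\<sigma> n) \<omega> = X t \<omega>"
      by (rule eventually_compose_filterlim[rotated])
    then show ?thesis by (simp add: \<sigma>_def)
  qed
  \<comment> \<open>Naming the floor by an integer \<open>z\<close> exhibits the set as a countable
    combination of events at the fixed times \<open>\<tau> n z\<close>.\<close>
  have "occupation y = {p \<in> space (lborel \<Otimes>\<^sub>M M). fst p \<in> {0..T} \<and>
      (\<exists>m. \<forall>n\<ge>m. \<exists>z. \<lfloor>real (Suc n) * fst p\<rfloor> = z \<and> snd p \<in> {\<omega> \<in> space M. X (\<tau> n z) \<omega> = y})}"
    (is "_ = ?R")
  proof (intro set_eqI iffI)
    fix p assume "p \<in> occupation y"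
    then have p: "fst p \<in> {0..T}" "snd p \<in> space M" "X (fst p) (snd p) = y"
      by (auto simp: occupation_def)
    with eventual[OF p(1,2)] show "p \<in> ?R"
      by (auto simp: eventually_sequentially space_pair_measure mem_Times_iff)
  next
    fix p assume R: "p \<in> ?R"
    then have p: "fst p \<in> {0..T}" "snd p \<in> space M"
      by (auto simp: space_pair_measure)
    have "\<forall>\<^sub>F n in sequentially. X (\<tau> n \<lfloor>real (Suc n) * fst p\<rfloor>) (snd p) = y"
      using R by (auto simp: eventually_sequentially)
    with eventual[OF p] have "\<forall>\<^sub>F n in sequentially. X (fst p) (snd p) = y"
      by eventually_elim simp
    then show "p \<in> occupation y"
      using p by (auto simp: occupation_def mem_Times_iff)
  qed
  also have "\<dots> \<in> sets (lborel \<Otimes>\<^sub>M M)"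
    using X_event[OF \<tau>] by measurable
  finally show ?thesis .
qed

sublocale time_space: pair_sigma_finite lborel M
  by unfold_locales

lemma indicator_occupation:
  "t \<in> {0..T} \<Longrightarrow> \<omega> \<in> space M \<Longrightarrow>
     indicator (occupation y) (t, \<omega>) = indicator {\<omega> \<in> space M. X t \<omega> = y} \<omega>"
  "t \<notin> {0..T} \<Longrightarrow> indicator (occupation y) (t, \<omega>) = 0"
  by (auto simp: occupation_def indicator_def)

text \<open>At a time in \<open>[0,T]\<close> exactly one configuration is occupied, outside none.
  The values lie in a semiring so that both the real and the \<open>ennreal\<close> costs are
  covered.\<close>

lemma sum_occupation:
  fixes h :: "(nat \<Rightarrow> bit) \<Rightarrow> 'b :: semiring_1"
  assumes "\<omega> \<in> space M"
  shows "(\<Sum>y\<in>configs N. indicator (occupation y) (t, \<omega>) * h y) = indicator {0..T} t * h (X t \<omega>)"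
proof (cases "t \<in> {0..T}")
  case True
  have "(\<Sum>y\<in>configs N. indicator (occupation y) (t, \<omega>) * h y) =
      (\<Sum>y\<in>configs N. if y = X t \<omega> then h y else 0)"
    using True assms by (intro sum.cong) (auto simp: occupation_def indicator_def)
  also have "\<dots> = h (X t \<omega>)"
    using X_in_configs[OF True assms] by simp
  finally show ?thesis using True by simp
next
  case False
  then show ?thesis by (simp add: indicator_occupation)
qed

text \<open>Fubini applies because each occupation set has product measure at most \<open>T\<close>;
  its section at time \<open>t\<close> has probability \<open>marginal t y\<close>.\<close>

lemma expectation_running_cost:
  fixes h :: "(nat \<Rightarrow> bit) \<Rightarrow> real"
  shows "integrable M (\<lambda>\<omega>. LINT t:{0..T}|lborel. h (X t \<omega>))"
    and "set_integrable lborel {0..T} (\<lambda>t. \<Sum>y\<in>configs N. marginal t y * h y)"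
    and "(\<integral>\<omega>. (LINT t:{0..T}|lborel. h (X t \<omega>)) \<partial>M) =
           (LINT t:{0..T}|lborel. \<Sum>y\<in>configs N. marginal t y * h y)"
proof -
  define K where "K t \<omega> = (\<Sum>y\<in>configs N. indicator (occupation y) (t, \<omega>) * h y)" for t \<omega>
  have "emeasure (lborel \<Otimes>\<^sub>M M) (occupation y) < \<infinity>" for y
  proof -
    have "emeasure (lborel \<Otimes>\<^sub>M M) (occupation y) \<le> emeasure (lborel \<Otimes>\<^sub>M M) ({0..T} \<times> space M)"
      by (intro emeasure_mono) (auto simp: occupation_def)
    also have "\<dots> = ennreal T"
      using T_pos by (subst emeasure_pair_measure_Times) (auto simp: emeasure_space_1)
    finally show ?thesis by (simp add: le_less_trans ennreal_less_top)
  qed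
  then have "integrable (lborel \<Otimes>\<^sub>M M) (\<lambda>p. \<Sum>y\<in>configs N. indicator (occupation y) p * h y)"
    by (intro Bochner_Integration.integrable_sum integrable_mult_left integrable_real_indicator occupation_measurable)
  then have K: "integrable (lborel \<Otimes>\<^sub>M M) (\<lambda>(t, \<omega>). K t \<omega>)"
    unfolding K_def case_prod_beta prod.collapse .
  have inner_t: "(\<integral>t. K t \<omega> \<partial>lborel) = (LINT t:{0..T}|lborel. h (X t \<omega>))" if "\<omega> \<in> space M" for \<omega>
    unfolding K_def sum_occupation[OF that] set_lebesgue_integral_def real_scaleR_def ..
  have inner_\<omega>: "(\<integral>\<omega>. K t \<omega> \<partial>M) = indicator {0..T} t *\<^sub>R (\<Sum>y\<in>configs N. marginal t y * h y)" for t
  proof (cases "t \<in> {0..T}")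
    case True
    have "(\<integral>\<omega>. K t \<omega> \<partial>M) = (\<integral>\<omega>. h (X t \<omega>) \<partial>M)"
      using True by (intro Bochner_Integration.integral_cong) (auto simp: K_def sum_occupation simp del: sum_indicator_mult sum_mult_indicator)
    then show ?thesis using expectation_eq_sum_marginal[OF True] True by simp
  next
    case False
    then show ?thesis by (simp add: K_def indicator_occupation)
  qed
  show "integrable M (\<lambda>\<omega>. LINT t:{0..T}|lborel. h (X t \<omega>))"
    using time_space.integrable_snd[OF K] by (subst (asm) Bochner_Integration.integrable_cong[OF refl inner_t]) auto
  show "set_integrable lborel {0..T} (\<lambda>t. \<Sum>y\<in>configs N. marginal t y * h y)"
    using time_space.integrable_fst[OF K] unfolding inner_\<omega> set_integrable_def .
  show "(\<integral>\<omega>. (LINT t:{0..T}|lborel. h (X t \<omega>)) \<partial>M) =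
           (LINT t:{0..T}|lborel. \<Sum>y\<in>configs N. marginal t y * h y)"
    using time_space.Fubini_integral[OF K] unfolding inner_\<omega> set_lebesgue_integral_def
    by (subst (asm) Bochner_Integration.integral_cong[OF refl inner_t]) (auto simp: set_lebesgue_integral_def)
qed

text \<open>Tonelli counterpart of the preceding lemma. It admits infinite values, as required for
  controls of infinite quadratic cost.\<close>

lemma nn_expectation_running_cost:
  fixes c :: "(nat \<Rightarrow> bit) \<Rightarrow> real \<Rightarrow> real"
  assumes c: "\<And>y. y \<in> configs N \<Longrightarrow> c y \<in> borel_measurable (restrict_space borel {0..T})"
    and c_nonneg: "\<And>y t. y \<in> configs N \<Longrightarrow> t \<in> {0..T} \<Longrightarrow> 0 \<le> c y t"
  shows "(\<integral>\<^sup>+\<omega>. (\<integral>\<^sup>+t\<in>{0..T}. ennreal (c (X t \<omega>) t) \<partial>lborel) \<partial>M) =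
           (\<integral>\<^sup>+t\<in>{0..T}. ennreal (\<Sum>y\<in>configs N. marginal t y * c y t) \<partial>lborel)"
proof -
  \<comment> \<open>\<open>c\<close> is measurable on \<open>[0,T]\<close> only; cutting it off
    makes it measurable on the whole line.\<close>
  define d where "d y t = indicator {0..T} t * c y t" for y t
  define K where "K t \<omega> = (\<Sum>y\<in>configs N. indicator (occupation y) (t, \<omega>) * ennreal (d y t))" for t \<omega>
  have [measurable]: "d y \<in> borel_measurable borel" if "y \<in> configs N" for y
    using c[OF that] unfolding d_def
    by (subst (asm) borel_measurable_restrict_space_iff) auto
  have "(\<lambda>p. \<Sum>y\<in>configs N. indicator (occupation y) p * ennreal (d y (fst p)))
      \<in> borel_measurable (lborel \<Otimes>\<^sub>M M)"
    by measurable
  then have K: "(\<lambda>(t, \<omega>). K t \<omega>) \<in> borel_measurable (lborel \<Otimes>\<^sub>M M)"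
    unfolding K_def case_prod_beta prod.collapse .
  have inner_t: "(\<integral>\<^sup>+t. K t \<omega> \<partial>lborel) = (\<integral>\<^sup>+t\<in>{0..T}. ennreal (c (X t \<omega>) t) \<partial>lborel)"
    if "\<omega> \<in> space M" for \<omega>
    unfolding K_def sum_occupation[OF that] by (intro nn_integral_cong) (auto simp: d_def indicator_def)
  have inner_\<omega>: "(\<integral>\<^sup>+\<omega>. K t \<omega> \<partial>M) =
      ennreal (\<Sum>y\<in>configs N. marginal t y * c y t) * indicator {0..T} t" for t
  proof (cases "t \<in> {0..T}")
    case True
    note [measurable] = X_event[OF True]
    have "(\<integral>\<^sup>+\<omega>. K t \<omega> \<partial>M) =
        (\<integral>\<^sup>+\<omega>. (\<Sum>y\<in>configs N. ennreal (c y t) * indicator {\<omega> \<in> space M. X t \<omega> = y} \<omega>) \<partial>M)"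
      using True by (intro nn_integral_cong) (simp add: K_def d_def indicator_occupation mult.commute)
    also have "\<dots> = (\<Sum>y\<in>configs N. ennreal (c y t) * emeasure M {\<omega> \<in> space M. X t \<omega> = y})"
      using X_event[OF True] by (subst nn_integral_sum) (auto simp: nn_integral_cmult_indicator)
    also have "\<dots> = (\<Sum>y\<in>configs N. ennreal (marginal t y * c y t))"
      using c_nonneg True
      by (intro sum.cong) (auto simp: emeasure_eq_measure marginal_def ennreal_mult mult.commute)
    also have "\<dots> = ennreal (\<Sum>y\<in>configs N. marginal t y * c y t)"
      using c_nonneg True by (intro sum_ennreal) auto
    finally show ?thesis using True by simp
  next
    case False
    then show ?thesis by (simp add: K_def indicator_occupation)
  qed
  have "(\<integral>\<^sup>+\<omega>. (\<integral>\<^sup>+t. K t \<omega> \<partial>lborel) \<partial>M) = (\<integral>\<^sup>+t. (\<integral>\<^sup>+\<omega>. K t \<omega> \<partial>M) \<partial>lborel)"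
    using time_space.Fubini'[OF K] .
  then show ?thesis
    unfolding inner_\<omega> by (subst (asm) nn_integral_cong[OF inner_t]) auto
qed

lemma control_value_measurable:
  assumes "k \<le> N" "is_control N T (a k)"
  shows "control_value N a k y \<in> borel_measurable (restrict_space borel {0..T})"
proof -
  have "control_value N a k y = a k (y k) (others0 N k y)"
    by (simp add: control_value_def fun_eq_iff)
  then show ?thesis using assms others0_le[of k N y] by (simp add: is_control_def)
qed

lemma control_value_nonneg:
  "k \<le> N \<Longrightarrow> is_control N T (a k) \<Longrightarrow> t \<in> {0..T} \<Longrightarrow> 0 \<le> control_value N a k y t"
  using others0_le[of k N y] by (simp add: is_control_def control_value_def)

text \<open>Exchanging expectation and time integral leaves only one-time marginals, so the joint
  law of the path does not enter the cost.\<close>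

lemma expected_cost_eq:
  assumes "k \<le> N" "is_control N T (a k)"
  shows "expected_cost N T f \<psi> a k M X =
    ereal ((LINT t:{0..T}|lborel. \<Sum>y\<in>configs N. marginal t y * f (y k) (frac0 N k y))
           + (\<Sum>y\<in>configs N. marginal T y * \<psi> (y k) (frac0 N k y)))
    + enn2ereal (\<integral>\<^sup>+t\<in>{0..T}. ennreal (\<Sum>y\<in>configs N. marginal t y * (1/2 * (control_value N a k y t)\<^sup>2)) \<partial>lborel)"
proof -
  note [measurable] = control_value_measurable[OF assms]
  have "(\<lambda>t. 1/2 * (control_value N a k y t)\<^sup>2) \<in> borel_measurable (restrict_space borel {0..T})" for y
    by measurable
  note nn = nn_expectation_running_cost[OF this]
  have "T \<in> {0..T}" using T_pos by simp
  note terminal = expectation_eq_sum_marginal[OF this, of "\<lambda>y. \<psi> (y k) (frac0 N k y)"]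
  note running = expectation_running_cost[of "\<lambda>y. f (y k) (frac0 N k y)"]
  show ?thesis
    unfolding expected_cost_def
    by (subst Bochner_Integration.integral_add[OF running(1) terminal(1)])
      (subst nn, simp_all add: running(3) terminal(2))
qed

end

section \<open>Deviation of a single player from the equilibrium strategy\<close>

text \<open>The control of player \<open>k\<close> is arbitrary, so the locale covers every
  deviation and also the equilibrium profile itself. \<open>D\<close> is strictly positive to allow
  division by \<open>sqrt D\<close>.\<close>

locale mfg_deviation = game_realization N T \<eta> a x0 M X
  for N :: nat and T \<eta> :: real and a :: "nat \<Rightarrow> control" and x0 :: "nat \<Rightarrow> bit"
    and M :: "'w measure" and X :: "real \<Rightarrow> 'w \<Rightarrow> nat \<Rightarrow> bit" +
  fixes k :: nat and f \<psi> u :: "bit \<Rightarrow> real \<Rightarrow> real" and \<theta> :: "real \<Rightarrow> real" and \<theta>0 L K D :: real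
  assumes N_pos: "1 \<le> N" and k: "k \<le> N" and control_k: "is_control N T (a k)"
    and others: "\<And>j. j \<noteq> k \<Longrightarrow> a j = (\<lambda>i n t. pos (u i t - u (1 - i) t))"
    and eta_nonneg: "0 \<le> \<eta>"
    and equilibrium: "mfg_equilibrium T \<eta> f \<psi> \<theta>0 \<theta> u"
    and lipschitz_f: "\<And>i. L-lipschitz_on {0..1} (f i)"
    and lipschitz_psi: "\<And>i. L-lipschitz_on {0..1} (\<psi> i)"
    and rate_le: "\<And>i s. s \<in> {0..T} \<Longrightarrow> pos (u i s - u (1 - i) s) + \<eta> \<le> K"
    and D: "(frac0 N k x0 - \<theta>0)\<^sup>2 + K * T / real N \<le> D" "0 < D"
begin

text \<open>The saving in future cost from leaving state \<open>i\<close>; its positive part is the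
  equilibrium control there.\<close>

definition gap :: "bit \<Rightarrow> real \<Rightarrow> real" where
  "gap i s = u i s - u (1 - i) s"

lemma theta_unit: "t \<in> {0..T} \<Longrightarrow> \<theta> t \<in> {0..1}"
  using equilibrium by (simp add: mfg_equilibrium_def)

lemma theta_deriv:
  "t \<in> {0..T} \<Longrightarrow> (\<theta> has_real_derivative
     (1 - \<theta> t) * (pos (gap 1 t) + \<eta>) - \<theta> t * (pos (gap 0 t) + \<eta>)) (at t within {0..T})"
  using equilibrium by (simp add: mfg_equilibrium_def gap_def)

lemma u_deriv:
  "t \<in> {0..T} \<Longrightarrow> (u i has_real_derivative
     - (f i (\<theta> t) - \<eta> * gap i t - 1/2 * (pos (gap i t))\<^sup>2)) (at t within {0..T})"
  using equilibrium unfolding mfg_equilibrium_def gap_def by blast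

lemma continuous_theta: "continuous_on {0..T} \<theta>"
  using theta_deriv by (rule DERIV_continuous_on)

lemma continuous_gap: "continuous_on {0..T} (gap i)"
  unfolding gap_def by (intro continuous_intros DERIV_continuous_on[OF u_deriv]) auto

lemma continuous_f_theta: "continuous_on {0..T} (\<lambda>t. f i (\<theta> t))"
  using theta_unit
  by (intro continuous_on_compose2[OF lipschitz_on_continuous_on[OF lipschitz_f] continuous_theta]) auto

text \<open>The fraction of others is a birth-death chain with steps \<open>1 / N\<close>: each of
  the \<open>n\<close> others in state 0 and the \<open>N - n\<close> in state 1 moves at its
  equilibrium rate, and a jump of \<open>k\<close> contributes zero.\<close>

lemma generator_frac0:
  fixes y :: "nat \<Rightarrow> bit"
  assumes s: "s \<in> {0..T}"
  defines "n \<equiv> others0 N k y" and "m \<equiv> frac0 N k y"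
  shows "generator (\<lambda>z. h (frac0 N k z)) y s =
     real n * (pos (gap 0 s) + \<eta>) * (h (m - 1 / N) - h m) + (real N - real n) * (pos (gap 1 s) + \<eta>) * (h (m + 1 / N) - h m)"
proof -
  let ?A = "(pos (gap 0 s) + \<eta>) * (h (m - 1 / N) - h m)"
  let ?B = "(pos (gap 1 s) + \<eta>) * (h (m + 1 / N) - h m)"
  let ?t = "\<lambda>j. jump_rate N \<eta> a j y s * (h (frac0 N k (flip j y)) - h (frac0 N k y))"
  have "generator (\<lambda>z. h (frac0 N k z)) y s = ?t k + (\<Sum>j\<in>{..N} - {k}. ?t j)"
    unfolding generator_def using k by (subst sum.remove[of _ k]) auto
  also have "?t k = 0" by simp
  \<comment> \<open>A player in state 0 contributes \<open>?A\<close>, one in state 1 contributes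
    \<open>?B\<close>. Writing this with \<open>of_bool\<close> makes the sum depend on the number
    of zeros alone.\<close>
  also have "(\<Sum>j\<in>{..N} - {k}. ?t j) = (\<Sum>j\<in>{..N} - {k}. ?B + of_bool (y j = 0) * (?A - ?B))"
  proof (intro sum.cong refl)
    fix j assume "j \<in> {..N} - {k}"
    then have j: "j \<le> N" "j \<noteq> k" by auto
    have rate: "jump_rate N \<eta> a j y s = pos (gap (y j) s) + \<eta>"
      using others[OF j(2)] by (simp add: jump_rate_def control_value_def gap_def)
    show "?t j = ?B + of_bool (y j = 0) * (?A - ?B)"
    proof (cases "y j = 0")
      case True
      have "frac0 N k (flip j y) = m - 1 / N"
        using others0_flip_from_0[of j N k y, OF j True] by (simp add: frac0_def m_def add_divide_distrib)
      then show ?thesis using True rate by (simp add: m_def)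
    next
      case False
      then have 1: "y j = 1" by simp
      have "frac0 N k (flip j y) = m + 1 / N"
        using others0_flip_from_1[of j N k y, OF j 1] by (simp add: frac0_def m_def add_divide_distrib)
      then show ?thesis using 1 rate by (simp add: m_def)
    qed
  qed
  also have "\<dots> = real (card ({..N} - {k})) * ?B + (\<Sum>j\<in>{..N} - {k}. of_bool (y j = 0)) * (?A - ?B)"
    by (simp only: sum.distrib sum_constant sum_distrib_right)
  also have "(\<Sum>j\<in>{..N} - {k}. of_bool (y j = 0)) = real n"
  proof -
    have "({..N} - {k}) \<inter> {j. y j = 0} = {j. j \<le> N \<and> j \<noteq> k \<and> y j = 0}" by auto
    then show ?thesis by (simp add: n_def others0_def sum_of_bool_eq)
  qed
  also have "card ({..N} - {k}) = N" using k by simp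
  finally show ?thesis by (simp add: algebra_simps)
qed

lemma generator_own:
  "generator (\<lambda>z. h (z k)) y s = jump_rate N \<eta> a k y s * (h (1 - y k) - h (y k))"
proof -
  have "generator (\<lambda>z. h (z k)) y s =
      (\<Sum>j\<le>N. if j = k then jump_rate N \<eta> a k y s * (h (1 - y k) - h (y k)) else 0)"
    unfolding generator_def by (intro sum.cong) (auto simp: flip_apply)
  then show ?thesis using k by simp
qed

text \<open>With \<open>m\<close> the fraction of others in state 0 and \<open>r\<^sub>i\<close> the equilibrium jump rate out of
  state \<open>i\<close>, the square \<open>(m - \<theta>)\<^sup>2\<close> has drift
  \<open>- 2 (r\<^sub>0 + r\<^sub>1) (m - \<theta>)\<^sup>2 + (m r\<^sub>0 + (1 - m) r\<^sub>1) / N\<close>; the first summand is dissipative, so no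
  Gronwall argument is needed.\<close>

lemma second_moment_le:
  assumes t: "t \<in> {0..T}"
  shows "(\<Sum>y\<in>configs N. marginal t y * (frac0 N k y - \<theta> t)\<^sup>2) \<le> D"
proof -
  define H where "H y s = (frac0 N k y - \<theta> s)\<^sup>2" for y s
  define \<theta>' where "\<theta>' s = (1 - \<theta> s) * (pos (gap 1 s) + \<eta>) - \<theta> s * (pos (gap 0 s) + \<eta>)" for s
  define H' where "H' y s = - 2 * (frac0 N k y - \<theta> s) * \<theta>' s" for y s
  have K: "pos (gap i s) + \<eta> \<le> K" if "s \<in> {0..T}" for i s
    using rate_le[OF that] by (simp add: gap_def)
  have "0 \<le> pos (gap 0 0) + \<eta>" using eta_nonneg by simp
  also have "\<dots> \<le> K" using K[of 0 0] T_pos by simp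
  finally have "0 \<le> K" .
  have d: "(H y has_real_derivative H' y s) (at s within {0..T})" if "s \<in> {0..T}" for y s
  proof -
    have "(\<theta> has_real_derivative \<theta>' s) (at s within {0..T})"
      unfolding \<theta>'_def by (rule theta_deriv[OF that])
    then show ?thesis
      unfolding H_def H'_def by (auto intro!: derivative_eq_intros simp: algebra_simps)
  qed
  have "continuous_on {0..T} \<theta>'"
    unfolding \<theta>'_def by (intro continuous_intros continuous_theta continuous_gap)
  then have c: "continuous_on {0..T} (H' y)" for y
    unfolding H'_def by (intro continuous_intros continuous_theta)
  have drift: "H' y s + generator (\<lambda>z. H z s) y s \<le> K / N" if s: "s \<in> {0..T}" for y s
  proof -
    define m where "m = frac0 N k y"
    define r0 where "r0 = pos (gap 0 s) + \<eta>"
    define r1 where "r1 = pos (gap 1 s) + \<eta>"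
    have r: "0 \<le> r0" "0 \<le> r1" "r0 \<le> K" "r1 \<le> K"
      using eta_nonneg K[OF s] by (auto simp: r0_def r1_def)
    have m: "0 \<le> m" "m \<le> 1" using frac0_unit_interval[OF k, of y] by (auto simp: m_def)
    have n: "real (others0 N k y) = N * m" using N_pos by (simp add: m_def frac0_def)
    have "generator (\<lambda>z. H z s) y s =
        N * m * r0 * ((m - 1/N - \<theta> s)\<^sup>2 - (m - \<theta> s)\<^sup>2) + (N - N * m) * r1 * ((m + 1/N - \<theta> s)\<^sup>2 - (m - \<theta> s)\<^sup>2)"
      unfolding H_def using generator_frac0[OF s, of "\<lambda>x. (x - \<theta> s)\<^sup>2" y]
      by (simp add: n flip: m_def r0_def r1_def)
    also have "\<dots> = m * r0 * (1/N - 2 * (m - \<theta> s)) + (1 - m) * r1 * (1/N + 2 * (m - \<theta> s))"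
      using N_pos by (simp add: power2_eq_square field_simps)
    finally have gen: "generator (\<lambda>z. H z s) y s =
        m * r0 * (1/N - 2 * (m - \<theta> s)) + (1 - m) * r1 * (1/N + 2 * (m - \<theta> s))" .
    \<comment> \<open>The drift of \<open>m\<close> minus \<open>\<theta>' s\<close> equals
      \<open>- (r0 + r1) * (m - \<theta> s)\<close>, so the cross terms combine into a nonpositive
      square.\<close>
    have "H' y s + generator (\<lambda>z. H z s) y s =
        (m * r0 + (1 - m) * r1) / N - 2 * (r0 + r1) * (m - \<theta> s)\<^sup>2"
      unfolding H'_def \<theta>'_def m_def[symmetric] r0_def[symmetric] r1_def[symmetric]
      unfolding gen by (simp add: power2_eq_square algebra_simps add_divide_distrib diff_divide_distrib)
    also have "\<dots> \<le> (m * r0 + (1 - m) * r1) / N"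
      using r by simp
    also have "\<dots> \<le> K / N"
      using convex_bound_le[of r0 K r1 m "1 - m"] r m by (intro divide_right_mono) auto
    finally show ?thesis .
  qed
  let ?I = "\<lambda>s. \<Sum>y\<in>configs N. marginal s y * (H' y s + generator (\<lambda>z. H z s) y s)"
  have "0 \<le> t" "t \<le> T" using t by auto
  note dyn = Dynkin_formula[OF this d c]
  have "(\<Sum>y\<in>configs N. marginal t y * H y t) = H x0 0 + (LINT s:{0..t}|lborel. ?I s)"
    by (rule dyn)
  also have "(LINT s:{0..t}|lborel. ?I s) \<le> (LINT s:{0..t}|lborel. K / N)"
  proof (rule set_integral_mono[OF dyn(1)])
    show "set_integrable lborel {0..t} (\<lambda>s. K / N)"
      using t by (intro set_integral_const_Icc) auto
    fix s assume "s \<in> {0..t}"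
    then have s: "s \<in> {0..T}" using t by auto
    have "?I s \<le> (\<Sum>y\<in>configs N. marginal s y * (K / N))"
      using drift[OF s] by (intro sum_mono mult_left_mono) auto
    also have "\<dots> = K / N"
      using sum_marginal[OF s] by (simp add: sum_distrib_right[symmetric] sum_divide_distrib[symmetric])
    finally show "?I s \<le> K / N" .
  qed
  also have "(LINT s:{0..t}|lborel. K / N) = K * t / N"
    using t by (simp add: set_lebesgue_integral_def)
  also have "K * t / N \<le> K * T / N"
    using t \<open>0 \<le> K\<close> by (intro divide_right_mono mult_left_mono) auto
  also have "H x0 0 = (frac0 N k x0 - \<theta>0)\<^sup>2"
    using equilibrium by (simp add: H_def mfg_equilibrium_def)
  finally show ?thesis using D(1) by (simp add: H_def)
qed

text \<open>Cauchy-Schwarz, carried out as the pointwise AM-GM inequality with weight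
  \<open>sqrt D\<close>; the two halves each contribute at most \<open>sqrt D / 2\<close>.\<close>

lemma mean_deviation_le:
  assumes t: "t \<in> {0..T}"
  shows "(\<Sum>y\<in>configs N. marginal t y * \<bar>frac0 N k y - \<theta> t\<bar>) \<le> sqrt D"
proof -
  let ?d = "\<lambda>y. frac0 N k y - \<theta> t"
  have "0 < sqrt D" using D by simp
  have AM_GM: "\<bar>z\<bar> \<le> (z\<^sup>2 / sqrt D + sqrt D) / 2" for z :: real
  proof -
    have "0 \<le> (\<bar>z\<bar> - sqrt D)\<^sup>2" by simp
    then have "2 * \<bar>z\<bar> * sqrt D \<le> z\<^sup>2 + sqrt D * sqrt D"
      by (simp add: power2_eq_square algebra_simps flip: abs_mult)
    then show ?thesis using \<open>0 < sqrt D\<close> by (simp add: field_simps)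
  qed
  have "(\<Sum>y\<in>configs N. marginal t y * \<bar>?d y\<bar>) \<le>
      (\<Sum>y\<in>configs N. marginal t y * (((?d y)\<^sup>2 / sqrt D + sqrt D) / 2))"
    using AM_GM by (intro sum_mono mult_left_mono) auto
  also have "\<dots> = (\<Sum>y\<in>configs N. marginal t y * (?d y)\<^sup>2 / sqrt D / 2 + marginal t y * sqrt D / 2)"
    by (intro sum.cong refl) (simp add: ring_distribs add_divide_distrib)
  also have "\<dots> = (\<Sum>y\<in>configs N. marginal t y * (?d y)\<^sup>2) / sqrt D / 2
      + (\<Sum>y\<in>configs N. marginal t y) * sqrt D / 2"
    by (simp only: sum.distrib sum_divide_distrib sum_distrib_right)
  also have "\<dots> \<le> D / sqrt D / 2 + sqrt D / 2"
    using second_moment_le[OF t] sum_marginal[OF t] \<open>0 < sqrt D\<close>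
    by (simp add: divide_right_mono)
  also have "\<dots> = sqrt D"
    using D by (simp add: real_div_sqrt)
  finally show ?thesis .
qed

text \<open>The price of replacing the empirical fraction by \<open>\<theta>\<close>, paid with
  \<open>g = f\<close> at every running time and with \<open>g = \<psi>\<close> at time
  \<open>T\<close>.\<close>

lemma cost_deviation_le:
  assumes t: "t \<in> {0..T}" and g: "\<And>i. L-lipschitz_on {0..1} (g i)"
  shows "\<bar>(\<Sum>y\<in>configs N. marginal t y * g (y k) (frac0 N k y))
          - (\<Sum>y\<in>configs N. marginal t y * g (y k) (\<theta> t))\<bar> \<le> L * sqrt D"
proof -
  have L: "0 \<le> L" using g lipschitz_on_nonneg by blast
  have lip: "\<bar>g (y k) (frac0 N k y) - g (y k) (\<theta> t)\<bar> \<le> L * \<bar>frac0 N k y - \<theta> t\<bar>" for y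
    using lipschitz_onD[OF g frac0_unit_interval[OF k] theta_unit[OF t]] by (simp add: dist_real_def)
  have "\<bar>\<Sum>y\<in>configs N. marginal t y * (g (y k) (frac0 N k y) - g (y k) (\<theta> t))\<bar> \<le>
      (\<Sum>y\<in>configs N. marginal t y * (L * \<bar>frac0 N k y - \<theta> t\<bar>))"
    using lip by (intro order_trans[OF sum_abs] sum_mono) (auto simp: abs_mult intro!: mult_left_mono)
  also have "\<dots> = L * (\<Sum>y\<in>configs N. marginal t y * \<bar>frac0 N k y - \<theta> t\<bar>)"
    by (simp add: sum_distrib_left algebra_simps)
  also have "\<dots> \<le> L * sqrt D"
    using mean_deviation_le[OF t] L by (rule mult_left_mono)
  finally show ?thesis by (simp add: sum_subtractf right_diff_distrib)
qed

section \<open>Verification argument for the cost of player \<open>k\<close>\<close>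

definition control_rate :: "(nat \<Rightarrow> bit) \<Rightarrow> real \<Rightarrow> real" where
  "control_rate y s = control_value N a k y s"

text \<open>Time derivative plus generator of \<open>u\<close> at the player's own state, with the
  Hamilton-Jacobi-Bellman equation inserted; the \<open>\<eta>\<close> terms have cancelled.\<close>

definition value_drift :: "(nat \<Rightarrow> bit) \<Rightarrow> real \<Rightarrow> real" where
  "value_drift y s = 1/2 * (pos (gap (y k) s))\<^sup>2 - control_rate y s * gap (y k) s - f (y k) (\<theta> s)"

text \<open>Dynkin's formula for \<open>H y s = u (y k) s\<close>; at time \<open>T\<close> the
  terminal condition turns \<open>u\<close> into \<open>\<psi>\<close>.\<close>

lemma verification:
  shows "set_integrable lborel {0..T} (\<lambda>s. \<Sum>y\<in>configs N. marginal s y * value_drift y s)"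
    and "(\<Sum>y\<in>configs N. marginal T y * \<psi> (y k) (\<theta> T)) = u (x0 k) 0 +
           (LINT s:{0..T}|lborel. \<Sum>y\<in>configs N. marginal s y * value_drift y s)"
proof -
  define H' where "H' y s = - (f (y k) (\<theta> s) - \<eta> * gap (y k) s - 1/2 * (pos (gap (y k) s))\<^sup>2)" for y :: "nat \<Rightarrow> bit" and s
  have d: "(u (y k) has_real_derivative H' y s) (at s within {0..T})" if "s \<in> {0..T}" for y s
    unfolding H'_def using u_deriv[OF that] .
  have c: "continuous_on {0..T} (H' y)" for y
    unfolding H'_def by (intro continuous_intros continuous_f_theta continuous_gap)
  have "u (1 - i) s - u i s = - gap i s" for i s by (simp add: gap_def)
  then have "generator (\<lambda>z. u (z k) s) y s = - (jump_rate N \<eta> a k y s * gap (y k) s)" for y s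
    using generator_own[of "\<lambda>i. u i s" y s] by (simp only: mult_minus_right)
  note gen = this
  have eq: "H' y s + generator (\<lambda>z. u (z k) s) y s = value_drift y s" for y s
    unfolding gen by (simp add: H'_def value_drift_def jump_rate_def control_rate_def algebra_simps)
  have \<psi>: "u i T = \<psi> i (\<theta> T)" for i
    using equilibrium by (simp add: mfg_equilibrium_def)
  show "set_integrable lborel {0..T} (\<lambda>s. \<Sum>y\<in>configs N. marginal s y * value_drift y s)"
    "(\<Sum>y\<in>configs N. marginal T y * \<psi> (y k) (\<theta> T)) = u (x0 k) 0 +
           (LINT s:{0..T}|lborel. \<Sum>y\<in>configs N. marginal s y * value_drift y s)"
    using Dynkin_formula[OF less_imp_le[OF T_pos] order_refl, of "\<lambda>y. u (y k)" H'] d c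
    unfolding eq \<psi> by auto
qed

definition energy :: "real \<Rightarrow> real" where
  "energy s = (\<Sum>y\<in>configs N. marginal s y * (1/2 * (control_rate y s)\<^sup>2))"

text \<open>Expected running cost plus the drift of \<open>u\<close> along the player's own state: up to replacing
  \<open>frac0\<close> by \<open>\<theta>\<close> in \<open>f\<close> it is a Hamiltonian gap, which is nonnegative and vanishes for the equilibrium
  strategy.\<close>

definition excess :: "real \<Rightarrow> real" where
  "excess s = (\<Sum>y\<in>configs N. marginal s y * f (y k) (frac0 N k y))
     + (\<Sum>y\<in>configs N. marginal s y * value_drift y s) + energy s"

lemma energy_nonneg: "0 \<le> energy s"
  unfolding energy_def by (intro sum_nonneg mult_nonneg_nonneg) auto

lemma energy_measurable: "(\<lambda>s. indicator {0..T} s * energy s) \<in> borel_measurable borel"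
proof -
  have m [measurable]: "(\<lambda>s. indicator {0..T} s * marginal s y) \<in> borel_measurable borel" if "y \<in> configs N" for y
  proof -
    \<comment> \<open>A marginal is the expectation of an indicator function of the configuration,
      so Fubini gives its measurability in time.\<close>
    have "(\<lambda>s. \<Sum>z\<in>configs N. marginal s z * (if z = y then 1 else 0)) = (\<lambda>s. marginal s y)"
      using that by (simp add: if_distrib cong: if_cong)
    then have "integrable lborel (\<lambda>s. indicator {0..T} s * marginal s y)"
      using expectation_running_cost(2)[of "\<lambda>z. if z = y then 1 else 0"] by (simp add: set_integrable_def)
    then show ?thesis by auto
  qed
  have c [measurable]: "(\<lambda>s. indicator {0..T} s * control_rate y s) \<in> borel_measurable borel" for y
    using control_value_measurable[OF k control_k, of y]
    by (subst (asm) borel_measurable_restrict_space_iff) (auto simp: control_rate_def)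
  have "(\<lambda>s. \<Sum>y\<in>configs N. (indicator {0..T} s * marginal s y) * (1/2 * (indicator {0..T} s * control_rate y s)\<^sup>2))
      \<in> borel_measurable borel"
    by measurable
  also have "(\<lambda>s. \<Sum>y\<in>configs N. (indicator {0..T} s * marginal s y) * (1/2 * (indicator {0..T} s * control_rate y s)\<^sup>2))
      = (\<lambda>s. indicator {0..T} s * energy s)"
    by (auto simp: fun_eq_iff energy_def indicator_def)
  finally show ?thesis .
qed

text \<open>Dynkin's formula for \<open>u\<close> trades the terminal cost at
  \<open>\<theta> T\<close> for \<open>u (x0 k) 0\<close> plus a time integral. Finite energy lets
  the extended-valued control cost be written as a real integral.\<close>

lemma expected_cost_eq_excess:
  assumes fin: "(\<integral>\<^sup>+s\<in>{0..T}. ennreal (energy s) \<partial>lborel) < \<infinity>"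
  shows "set_integrable lborel {0..T} excess"
    and "expected_cost N T f \<psi> a k M X = ereal (u (x0 k) 0 + (LINT s:{0..T}|lborel. excess s)
      + ((\<Sum>y\<in>configs N. marginal T y * \<psi> (y k) (frac0 N k y))
         - (\<Sum>y\<in>configs N. marginal T y * \<psi> (y k) (\<theta> T))))"
proof -
  have nn: "(\<integral>\<^sup>+s\<in>{0..T}. ennreal (energy s) \<partial>lborel) = (\<integral>\<^sup>+s. ennreal (indicator {0..T} s * energy s) \<partial>lborel)"
    by (intro nn_integral_cong) (auto simp: indicator_def)
  have int: "integrable lborel (\<lambda>s. indicator {0..T} s * energy s)"
    using fin energy_measurable energy_nonneg unfolding nn
    by (intro integrableI_nonneg) (auto simp: indicator_def)
  then have E: "set_integrable lborel {0..T} energy"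
    by (simp add: set_integrable_def)
  have Q: "(\<integral>\<^sup>+s\<in>{0..T}. ennreal (energy s) \<partial>lborel) = ennreal (LINT s:{0..T}|lborel. energy s)"
    unfolding nn using energy_nonneg
    by (subst nn_integral_eq_integral[OF int]) (auto simp: set_lebesgue_integral_def)
  have Q0: "0 \<le> (LINT s:{0..T}|lborel. energy s)"
    unfolding set_lebesgue_integral_def using energy_nonneg by (intro Bochner_Integration.integral_nonneg) auto
  note F = expectation_running_cost(2)[of "\<lambda>y. f (y k) (frac0 N k y)"]
  note FV = set_integral_add[OF F verification(1)]
  show "set_integrable lborel {0..T} excess"
    unfolding excess_def by (intro set_integral_add F verification(1) E)
  have "(LINT s:{0..T}|lborel. excess s) =
      (LINT s:{0..T}|lborel. \<Sum>y\<in>configs N. marginal s y * f (y k) (frac0 N k y))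
      + (LINT s:{0..T}|lborel. \<Sum>y\<in>configs N. marginal s y * value_drift y s)
      + (LINT s:{0..T}|lborel. energy s)"
    unfolding excess_def using set_integral_add(2)[OF FV(1) E] FV(2) by simp
  then show "expected_cost N T f \<psi> a k M X = ereal (u (x0 k) 0 + (LINT s:{0..T}|lborel. excess s)
      + ((\<Sum>y\<in>configs N. marginal T y * \<psi> (y k) (frac0 N k y))
         - (\<Sum>y\<in>configs N. marginal T y * \<psi> (y k) (\<theta> T))))"
    unfolding expected_cost_eq[OF k control_k] control_rate_def[symmetric] energy_def[symmetric] Q
    using Q0 verification(2) by (simp add: enn2ereal_ennreal)
qed

text \<open>Adding and subtracting \<open>f\<close> at \<open>\<theta> s\<close> separates the mean
  field replacement error from the Hamiltonian gap in the last sum.\<close>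

lemma excess_eq:
  "excess s = (\<Sum>y\<in>configs N. marginal s y * f (y k) (frac0 N k y))
     - (\<Sum>y\<in>configs N. marginal s y * f (y k) (\<theta> s))
     + (\<Sum>y\<in>configs N. marginal s y *
          (1/2 * (control_rate y s)\<^sup>2 - control_rate y s * gap (y k) s + 1/2 * (pos (gap (y k) s))\<^sup>2))"
  unfolding excess_def energy_def value_drift_def
  by (simp add: sum.distrib sum_subtractf algebra_simps)

text \<open>The Hamiltonian gap is nonnegative, so only replacement errors are lost:
  \<open>L * sqrt D\<close> per unit of running time and once more at the end, whence the factor
  \<open>T + 1\<close>. With infinite energy the cost is infinite.\<close>

lemma expected_cost_ge:
  "ereal (u (x0 k) 0 - L * (T + 1) * sqrt D) \<le> expected_cost N T f \<psi> a k M X"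
proof (cases "(\<integral>\<^sup>+s\<in>{0..T}. ennreal (energy s) \<partial>lborel) < \<infinity>")
  case True
  have "- (L * sqrt D) \<le> excess s" if s: "s \<in> {0..T}" for s
  proof -
    \<comment> \<open>For \<open>g \<ge> 0\<close> this is a complete square; for
      \<open>g < 0\<close> each term is nonnegative because \<open>c \<ge> 0\<close>.\<close>
    have "0 \<le> 1/2 * c\<^sup>2 - c * g + 1/2 * (pos g)\<^sup>2" if "0 \<le> c" for c g :: real
    proof (cases "0 \<le> g")
      case True
      have "1/2 * c\<^sup>2 - c * g + 1/2 * g\<^sup>2 = 1/2 * (c - g)\<^sup>2"
        by (simp add: power2_eq_square algebra_simps)
      moreover have "pos g = g" using True by simp
      ultimately have "1/2 * c\<^sup>2 - c * g + 1/2 * (pos g)\<^sup>2 = 1/2 * (c - g)\<^sup>2" by (simp only:)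
      moreover have "0 \<le> 1/2 * (c - g)\<^sup>2" by simp
      ultimately show ?thesis by (simp only:)
    next
      case False
      then have "c * g \<le> 0" using that by (simp add: mult_nonneg_nonpos)
      then have "0 \<le> 1/2 * c\<^sup>2 - c * g" using zero_le_power2[of c] by linarith
      moreover have "pos g = 0" using False by simp
      ultimately show ?thesis by (simp only: power_zero_numeral mult_zero_right add_0_right)
    qed
    then have "0 \<le> (\<Sum>y\<in>configs N. marginal s y *
          (1/2 * (control_rate y s)\<^sup>2 - control_rate y s * gap (y k) s + 1/2 * (pos (gap (y k) s))\<^sup>2))"
      using control_value_nonneg[OF k control_k s]
      by (intro sum_nonneg mult_nonneg_nonneg) (auto simp: control_rate_def)
    then show ?thesis
      unfolding excess_eq using cost_deviation_le[of s f, OF s lipschitz_f] by linarith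
  qed
  then have "(LINT s:{0..T}|lborel. - (L * sqrt D)) \<le> (LINT s:{0..T}|lborel. excess s)"
    by (intro set_integral_mono set_integral_const_Icc(1)[OF less_imp_le[OF T_pos]]
        expected_cost_eq_excess(1)[OF True])
  moreover have "T \<in> {0..T}" using T_pos by simp
  note cost_deviation_le[of T \<psi>, OF this lipschitz_psi]
  ultimately show ?thesis
    unfolding expected_cost_eq_excess(2)[OF True] set_integral_const_Icc(2)[OF less_imp_le[OF T_pos]]
    by (simp add: algebra_simps)
next
  case False
  then have "(\<integral>\<^sup>+s\<in>{0..T}. ennreal (energy s) \<partial>lborel) = \<top>"
    by (metis infinity_ennreal_def less_top)
  then show ?thesis
    unfolding expected_cost_eq[OF k control_k] control_rate_def[symmetric] energy_def[symmetric] by simp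
qed

text \<open>The equilibrium control attains the minimum in the Hamiltonian, so the gap vanishes and
  only the replacement errors remain; its boundedness gives finite energy.\<close>

lemma expected_cost_le:
  assumes own: "a k = (\<lambda>i n t. pos (u i t - u (1 - i) t))"
  shows "expected_cost N T f \<psi> a k M X \<le> ereal (u (x0 k) 0 + L * (T + 1) * sqrt D)"
proof -
  have c: "control_rate y s = pos (gap (y k) s)" for y s
    by (simp add: control_rate_def control_value_def own gap_def)
  have "energy s \<le> 1/2 * K\<^sup>2" if s: "s \<in> {0..T}" for s
  proof -
    \<comment> \<open>\<open>K\<close> bounds the control plus \<open>\<eta>\<close>, hence the
      control alone, as \<open>\<eta> \<ge> 0\<close>.\<close>
    have "pos (gap i s) \<le> K" for i
      using rate_le[OF s, of i] eta_nonneg unfolding gap_def by linarith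
    then have "energy s \<le> (\<Sum>y\<in>configs N. marginal s y * (1/2 * K\<^sup>2))"
      unfolding energy_def c by (intro sum_mono mult_left_mono power_mono) auto
    then show ?thesis
      using sum_marginal[OF s] by (simp add: sum_distrib_right[symmetric] sum_divide_distrib[symmetric])
  qed
  then have "(\<integral>\<^sup>+s\<in>{0..T}. ennreal (energy s) \<partial>lborel) \<le> (\<integral>\<^sup>+s\<in>{0..T}. ennreal (1/2 * K\<^sup>2) \<partial>lborel)"
    by (intro nn_integral_mono) (auto simp: indicator_def intro!: ennreal_leI)
  also have "\<dots> = ennreal (1/2 * K\<^sup>2) * ennreal T"
    using T_pos by (subst nn_integral_cmult_indicator) auto
  also have "\<dots> < \<infinity>" by (simp add: ennreal_mult_less_top)
  finally have fin: "(\<integral>\<^sup>+s\<in>{0..T}. ennreal (energy s) \<partial>lborel) < \<infinity>" .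
  have "pos g * pos g = pos g * g" for g :: real by (simp add: max_def)
  then have "1/2 * (pos g)\<^sup>2 - pos g * g + 1/2 * (pos g)\<^sup>2 = 0" for g :: real
    by (simp add: power2_eq_square)
  then have "excess s \<le> L * sqrt D" if s: "s \<in> {0..T}" for s
    unfolding excess_eq c using cost_deviation_le[of s f, OF s lipschitz_f] by simp
  then have "(LINT s:{0..T}|lborel. excess s) \<le> (LINT s:{0..T}|lborel. L * sqrt D)"
    by (intro set_integral_mono set_integral_const_Icc(1)[OF less_imp_le[OF T_pos]]
        expected_cost_eq_excess(1)[OF fin])
  moreover have "T \<in> {0..T}" using T_pos by simp
  note cost_deviation_le[of T \<psi>, OF this lipschitz_psi]
  ultimately show ?thesis
    unfolding expected_cost_eq_excess(2)[OF fin] set_integral_const_Icc(2)[OF less_imp_le[OF T_pos]]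
    by (simp add: algebra_simps)
qed

end


section \<open>The approximate Nash property\<close>

text \<open>Each \<open>u i\<close> is differentiable, hence continuous on the compact time
  interval. Continuity also yields the measurability required of a control.\<close>

lemma equilibrium_strategy_bounded:
  assumes "mfg_equilibrium T \<eta> f \<psi> \<theta>0 \<theta> u"
  shows "continuous_on {0..T} (\<lambda>t. pos (u i t - u (1 - i) t))"
    and "\<exists>K. \<forall>i. \<forall>t\<in>{0..T}. pos (u i t - u (1 - i) t) + \<eta> \<le> K"
proof -
  have "continuous_on {0..T} (u i)" for i
  proof (rule DERIV_continuous_on)
    show "(u i has_real_derivative
        - (f i (\<theta> t) - \<eta> * (u i t - u (1 - i) t) - 1/2 * (pos (u i t - u (1 - i) t))\<^sup>2)) (at t within {0..T})"
      if "t \<in> {0..T}" for t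
      using assms that unfolding mfg_equilibrium_def by blast
  qed
  then show c: "continuous_on {0..T} (\<lambda>t. pos (u i t - u (1 - i) t))" for i
    by (intro continuous_intros)
  have "\<exists>K. \<forall>t\<in>{0..T}. pos (u i t - u (1 - i) t) \<le> K" for i
  proof -
    obtain B where B: "\<And>x. x \<in> (\<lambda>t. pos (u i t - u (1 - i) t)) ` {0..T} \<Longrightarrow> norm x \<le> B"
      using compact_imp_bounded[OF compact_continuous_image[OF c compact_Icc]] unfolding bounded_iff by blast
    have "pos (u i t - u (1 - i) t) \<le> B" if "t \<in> {0..T}" for t
      using B[OF imageI[OF that]] unfolding real_norm_def by linarith
    then show ?thesis by blast
  qed
  then obtain K0 K1 where K: "\<And>t. t \<in> {0..T} \<Longrightarrow> pos (u 0 t - u (1 - 0) t) \<le> K0"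
    "\<And>t. t \<in> {0..T} \<Longrightarrow> pos (u 1 t - u (1 - 1) t) \<le> K1"
    by blast
  have "pos (u i t - u (1 - i) t) + \<eta> \<le> max K0 K1 + \<eta>" if "t \<in> {0..T}" for i t
  proof (cases i)
    assume i: "i = 0"
    show ?thesis unfolding i using K(1)[OF that] by linarith
  next
    assume i: "i = 1"
    show ?thesis unfolding i using K(2)[OF that] by linarith
  qed
  then show "\<exists>K. \<forall>i. \<forall>t\<in>{0..T}. pos (u i t - u (1 - i) t) + \<eta> \<le> K"
    by blast
qed

text \<open>The two counts differ at most by player \<open>k\<close>. This links the convergence
  hypothesis, which counts all \<open>N + 1\<close> players, to the fraction seen by each player,
  uniformly in \<open>k\<close>.\<close>

lemma frac0_near_fraction:
  assumes "k \<le> N" "1 \<le> N"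
  shows "\<bar>frac0 N k x - real (card {j. j \<le> N \<and> x j = 0}) / real N\<bar> \<le> 1 / real N"
proof -
  have "others0 N k x \<le> card {j. j \<le> N \<and> x j = 0}"
    unfolding others0_def by (intro card_mono) auto
  moreover have "card {j. j \<le> N \<and> x j = 0} \<le> card (insert k {j. j \<le> N \<and> j \<noteq> k \<and> x j = 0})"
    by (intro card_mono) auto
  then have "card {j. j \<le> N \<and> x j = 0} \<le> Suc (others0 N k x)"
    unfolding others0_def by simp
  ultimately have "\<bar>real (others0 N k x) - real (card {j. j \<le> N \<and> x j = 0})\<bar> \<le> 1"
    by linarith
  then show ?thesis
    using assms by (simp add: frac0_def divide_right_mono flip: diff_divide_distrib)
qed

theorem mainTheorem4:
  fixes T \<eta> \<theta>0 :: real
    and f \<psi> u :: "bit \<Rightarrow> real \<Rightarrow> real"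
    and \<theta> :: "real \<Rightarrow> real"
    and x0 :: "nat \<Rightarrow> nat \<Rightarrow> bit"
  assumes "0 < T" and "0 \<le> \<eta>"
    and "admissible_cost f" and "admissible_cost \<psi>"
    and "\<theta>0 \<in> {0..1}"
    and "mfg_equilibrium T \<eta> f \<psi> \<theta>0 \<theta> u"
    and "\<And>N. x0 N \<in> configs N"
    and "(\<lambda>N. real (card {j. j \<le> N \<and> x0 N j = 0}) / real N) \<longlonglongrightarrow> \<theta>0"
  shows "\<exists>\<epsilon> :: nat \<Rightarrow> real. (\<forall>N. 0 \<le> \<epsilon> N) \<and> \<epsilon> \<longlonglongrightarrow> 0 \<and>
           (\<forall>N\<ge>1. eps_nash N T \<eta> f \<psi> (x0 N) (\<lambda>k i n t. pos (u i t - u (1 - i) t)) (\<epsilon> N))"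
proof -
  let ?\<alpha> = "\<lambda>i (n::nat) t. pos (u i t - u (1 - i) t)"
  obtain Lf L\<psi> where Lf: "\<And>i. Lf-lipschitz_on {0..1} (f i)" and L\<psi>: "\<And>i. L\<psi>-lipschitz_on {0..1} (\<psi> i)"
    using assms(3,4) unfolding admissible_cost_def by auto
  define L where "L = max Lf L\<psi>"
  have L: "L-lipschitz_on {0..1} (f i)" "L-lipschitz_on {0..1} (\<psi> i)" for i
    unfolding L_def by (intro lipschitz_on_le[OF Lf] lipschitz_on_le[OF L\<psi>]; simp)+
  then have "0 \<le> L" using lipschitz_on_nonneg by blast
  obtain K where K: "\<And>i t. t \<in> {0..T} \<Longrightarrow> pos (u i t - u (1 - i) t) + \<eta> \<le> K"
    using equilibrium_strategy_bounded(2)[OF assms(6)] by blast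
  have "0 \<le> pos (u 0 0 - u (1 - 0) 0) + \<eta>" using assms(2) by simp
  also have "\<dots> \<le> K" using assms(1) by (intro K) simp
  finally have "0 \<le> K" .
  define c where "c N = real (card {j. j \<le> N \<and> x0 N j = 0}) / real N" for N
  \<comment> \<open>A bound common to all players: \<open>1 / real N\<close> inside the square
    accounts for the omitted player, and the \<open>+ 1\<close> keeps \<open>D N\<close> positive
    for \<open>N \<ge> 1\<close> even if \<open>K = 0\<close>.\<close>
  define D where "D N = (\<bar>c N - \<theta>0\<bar> + 1 / real N)\<^sup>2 + (K * T + 1) / real N" for N
  \<comment> \<open>The factor 2: the upper bound for the equilibrium cost and the lower bound for
    the deviation cost each lose \<open>L * (T + 1) * sqrt (D N)\<close>.\<close>
  define \<epsilon> where "\<epsilon> N = 2 * (L * (T + 1) * sqrt (D N))" for N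
  have "0 \<le> D N" for N
    using \<open>0 \<le> K\<close> assms(1) by (simp add: D_def)
  then have \<epsilon>_nonneg: "0 \<le> \<epsilon> N" for N
    using \<open>0 \<le> L\<close> assms(1) by (simp add: \<epsilon>_def)
  have "D \<longlonglongrightarrow> (\<bar>\<theta>0 - \<theta>0\<bar> + 0)\<^sup>2 + 0"
    unfolding D_def using assms(8)
    by (intro tendsto_intros lim_const_over_n[THEN tendsto_eq_rhs] lim_1_over_n) (auto simp: c_def)
  then have "\<epsilon> \<longlonglongrightarrow> 2 * (L * (T + 1) * sqrt 0)"
    unfolding \<epsilon>_def by (intro tendsto_intros) simp
  then have \<epsilon>_lim: "\<epsilon> \<longlonglongrightarrow> 0" by simp
  have "eps_nash N T \<eta> f \<psi> (x0 N) (\<lambda>k. ?\<alpha>) (\<epsilon> N)" if N: "1 \<le> N" for N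
  proof -
    have "?\<alpha> i n \<in> borel_measurable (restrict_space borel {0..T})" for i n
      using equilibrium_strategy_bounded(1)[OF assms(6)] by (rule borel_measurable_continuous_on_restrict)
    then have \<alpha>: "is_control N T ?\<alpha>"
      by (simp add: is_control_def)
    have D: "(frac0 N k (x0 N) - \<theta>0)\<^sup>2 + K * T / real N \<le> D N" "0 < D N" if "k \<le> N" for k
    proof -
      have "\<bar>frac0 N k (x0 N) - \<theta>0\<bar> \<le> \<bar>c N - \<theta>0\<bar> + 1 / real N"
        using frac0_near_fraction[OF that N, of "x0 N"] unfolding c_def by linarith
      then have "(frac0 N k (x0 N) - \<theta>0)\<^sup>2 \<le> (\<bar>c N - \<theta>0\<bar> + 1 / real N)\<^sup>2"
        by (rule abs_le_square_iff[THEN iffD1, OF order_trans]) simp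
      then show "(frac0 N k (x0 N) - \<theta>0)\<^sup>2 + K * T / real N \<le> D N"
        by (simp add: D_def add_divide_distrib add_increasing2)
      show "0 < D N"
        unfolding D_def using N \<open>0 \<le> K\<close> assms(1)
        by (intro add_nonneg_pos divide_pos_pos add_nonneg_pos) auto
    qed
    have deviation: "mfg_deviation N T \<eta> ((\<lambda>k. ?\<alpha>)(k := b)) (x0 N) M X k f \<psi> u \<theta> \<theta>0 L K (D N)"
      if "k \<le> N" "is_control N T b" "game_process N T \<eta> ((\<lambda>k. ?\<alpha>)(k := b)) (x0 N) M X"
      for k b and M :: "path measure" and X
      using that N L K D[OF that(1)] assms(1,2,6) by unfold_locales auto
    show ?thesis
      unfolding eps_nash_def
    proof (intro conjI allI impI \<alpha>)
      fix k b and M M' :: "path measure" and X X'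
      assume k: "k \<le> N" and b: "is_control N T b"
        and X: "game_process N T \<eta> (\<lambda>k. ?\<alpha>) (x0 N) M X"
        and X': "game_process N T \<eta> ((\<lambda>k. ?\<alpha>)(k := b)) (x0 N) M' X'"
      let ?e = "L * (T + 1) * sqrt (D N)"
      \<comment> \<open>The equilibrium profile is the trivial deviation, so the same locale bounds
        its cost from above.\<close>
      have "(\<lambda>k. ?\<alpha>)(k := ?\<alpha>) = (\<lambda>k. ?\<alpha>)" by (simp only: fun_upd_def if_cancel)
      then have "expected_cost N T f \<psi> (\<lambda>k. ?\<alpha>) k M X \<le> ereal (u (x0 N k) 0 + ?e)"
        using mfg_deviation.expected_cost_le[OF deviation[OF k \<alpha>, of M X]] X by simp
      also have "\<dots> = ereal (u (x0 N k) 0 - ?e) + ereal (\<epsilon> N)"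
        by (simp add: \<epsilon>_def)
      also have "\<dots> \<le> expected_cost N T f \<psi> ((\<lambda>k. ?\<alpha>)(k := b)) k M' X' + ereal (\<epsilon> N)"
        by (intro add_right_mono mfg_deviation.expected_cost_ge[OF deviation[OF k b X']])
      finally show "expected_cost N T f \<psi> (\<lambda>k. ?\<alpha>) k M X \<le>
          expected_cost N T f \<psi> ((\<lambda>k. ?\<alpha>)(k := b)) k M' X' + ereal (\<epsilon> N)" .
    qed
  qed
  then show ?thesis
    using \<epsilon>_nonneg \<epsilon>_lim by blast
qed

end
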